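(* Let $k\geq 3$ be an integer and let $G$ be a connected graph of order $n$ with minimum degree $\delta=\delta(G)$. Let $m=k+1$ if $\delta=1$, and let $m=\left\lfloor \frac{k}{\delta-1}\right\rfloor$ if $\delta\geq 2$. If $$|E(G)|\geq \binom{n-m-(k+1-m)(\delta+1)}{2}+(k+1-m)\binom{\delta+1}{2}+k+2,$$ then $pc(G)\leq k$.
   Context: All graphs are simple, finite and undirected. The order of a graph is its number of vertices. An edge-coloured graph is one in which each edge is assigned a colour (adjacent edges may receive the same colour). A path in an edge-coloured graph is a proper path if no two adjacent edges of the path have the same colour. An edge-coloured graph $G$ is properly connected if every pair of distinct vertices of $G$ is connected by a proper path. For a connected graph $G$, the proper connection number $pc(G)$ is the smallest number of colours needed to colour the edges of $G$ so that $G$ is properly connected. *)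

theory Defs
  imports Main
begin

text \<open>A simple graph is given by its vertex set \<open>V\<close> and its edge set \<open>E\<close>, whose members are
  two-element subsets of \<open>V\<close>.\<close>

definition simple_graph :: "'a set \<Rightarrow> 'a set set \<Rightarrow> bool" where
  "simple_graph V E \<longleftrightarrow> finite V \<and> (\<forall>e\<in>E. e \<subseteq> V \<and> card e = 2)"

definition degree :: "'a set set \<Rightarrow> 'a \<Rightarrow> nat" where
  "degree E v = card {e \<in> E. v \<in> e}"

definition min_degree :: "'a set \<Rightarrow> 'a set set \<Rightarrow> nat" where
  "min_degree V E = Min (degree E ` V)"

definition is_path :: "'a set \<Rightarrow> 'a set set \<Rightarrow> 'a \<Rightarrow> 'a list \<Rightarrow> 'a \<Rightarrow> bool" where
  "is_path V E u p v \<longleftrightarrow>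
     p \<noteq> [] \<and> hd p = u \<and> last p = v \<and> distinct p \<and> set p \<subseteq> V \<and>
     (\<forall>i. Suc i < length p \<longrightarrow> {p ! i, p ! Suc i} \<in> E)"

definition path_edges :: "'a list \<Rightarrow> 'a set set" where
  "path_edges p = {{p ! i, p ! Suc i} | i. Suc i < length p}"

definition connected_graph :: "'a set \<Rightarrow> 'a set set \<Rightarrow> bool" where
  "connected_graph V E \<longleftrightarrow> V \<noteq> {} \<and> (\<forall>u\<in>V. \<forall>v\<in>V. \<exists>p. is_path V E u p v)"

text \<open>Edge colourings need not be proper: \<open>c\<close> is an arbitrary function, and only its
  values on the edges matter.\<close>

definition proper_path ::
    "'a set \<Rightarrow> 'a set set \<Rightarrow> ('a set \<Rightarrow> 'c) \<Rightarrow> 'a \<Rightarrow> 'a list \<Rightarrow> 'a \<Rightarrow> bool" where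
  "proper_path V E c u p v \<longleftrightarrow>
     is_path V E u p v \<and>
     (\<forall>e\<in>path_edges p. \<forall>f\<in>path_edges p. e \<noteq> f \<and> e \<inter> f \<noteq> {} \<longrightarrow> c e \<noteq> c f)"

definition properly_connected :: "'a set \<Rightarrow> 'a set set \<Rightarrow> ('a set \<Rightarrow> 'c) \<Rightarrow> bool" where
  "properly_connected V E c \<longleftrightarrow>
     (\<forall>u\<in>V. \<forall>v\<in>V. u \<noteq> v \<longrightarrow> (\<exists>p. proper_path V E c u p v))"

text \<open>For a finite connected graph some number of colours always suffices (give all edges
  different colours), so the minimum below exists.\<close>

definition pc :: "'a set \<Rightarrow> 'a set set \<Rightarrow> nat" where
  "pc V E = (LEAST r. \<exists>c :: 'a set \<Rightarrow> nat. c ` E \<subseteq> {..<r} \<and> properly_connected V E c)"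

text \<open>Convention for size bounds: a binomial coefficient \<open>a choose 2\<close> counts the edges of a complete
  graph on \<open>a\<close> vertices and is \<open>0\<close> when \<open>a\<close> would be negative. Truncated subtraction on \<open>nat\<close> in the
  upper argument gives exactly this.\<close>

end

theory Submission
  imports Defs
begin

text \<open>Call a colouring strong if any two vertices are joined by two proper paths that differ both in
  their first and in their last colour. The union of two intersecting strongly coloured subgraphs
  is strong, and so is a properly coloured cycle; hence adding ears greedily, each closed up to a
  properly coloured cycle, yields a strong colouring with three colours of every bridgeless
  connected graph.

  A connected graph with at most \<open>k\<close> bridges, where \<open>k \<ge> 3\<close>, is obtained by gluing strongly coloured
  parts along the bridges. At a strong part each bridge end forbids at most one colour for every
  other one, so greedy choices and permutations of the colours of the parts give \<open>pc \<le> k\<close>.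

  If there are more than \<open>k\<close> bridges, removing \<open>k + 1\<close> of them leaves \<open>k + 2\<close> parts. At most \<open>m\<close> of these
  have order at most \<open>\<delta>\<close>, since such a part meets at least \<open>\<delta>\<close> ends of removed bridges, and
  convexity bounds the number of edges below the threshold.\<close>

section \<open>Properly coloured paths with prescribed end colours\<close>

text \<open>Only consecutive edges are compared; distinctness of the vertices is required
  separately, in \<open>conn_path\<close> and \<open>alt_cycle\<close>.\<close>

fun alt_path :: "'a set set \<Rightarrow> ('a set \<Rightarrow> 'c) \<Rightarrow> 'a list \<Rightarrow> bool" where
  "alt_path E c (x # y # p) \<longleftrightarrow>
     {x, y} \<in> E \<and> (p \<noteq> [] \<longrightarrow> c {x, y} \<noteq> c {y, hd p}) \<and> alt_path E c (y # p)"
| "alt_path E c p \<longleftrightarrow> True"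

text \<open>For lists with fewer than two vertices the value is junk; hence the guards
  \<open>tl p \<noteq> []\<close> and \<open>length p \<ge> 2\<close> below.\<close>

definition start_col :: "('a set \<Rightarrow> 'c) \<Rightarrow> 'a list \<Rightarrow> 'c" where
  "start_col c p = c {hd p, hd (tl p)}"

definition end_col :: "('a set \<Rightarrow> 'c) \<Rightarrow> 'a list \<Rightarrow> 'c" where
  "end_col c p = c {last (butlast p), last p}"

lemma start_col_Cons [simp]: "start_col c (x # y # p) = c {x, y}"
  by (simp add: start_col_def)

lemma end_col_Cons [simp]:
  "end_col c (x # y # p) = (if p = [] then c {x, y} else end_col c (y # p))"
  by (simp add: end_col_def)

lemma end_col_snoc: "p \<noteq> [] \<Longrightarrow> end_col c (p @ [x]) = c {last p, x}"
  by (simp add: end_col_def butlast_append)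

lemma end_col_snoc2 [simp]:
  "end_col c (p @ [x, y]) = c {x, y}" "end_col c (z # p @ [x, y]) = c {x, y}"
  by (simp_all add: end_col_def butlast_append)

lemma start_col_append:
  "p \<noteq> [] \<Longrightarrow> q \<noteq> [] \<Longrightarrow>
    start_col c (p @ q) = (if tl p = [] then c {hd p, hd q} else start_col c p)"
  by (cases p; cases "tl p"; cases q) auto

lemma end_col_append:
  "p \<noteq> [] \<Longrightarrow> q \<noteq> [] \<Longrightarrow>
    end_col c (p @ q) = (if tl q = [] then c {last p, last q} else end_col c q)"
proof (induction p)
  case (Cons x p)
  then show ?case by (cases p; cases q; cases "tl q") auto
qed simp

lemma end_col_rev: "length p \<ge> 2 \<Longrightarrow> end_col c (rev p) = start_col c p"
  by (cases p; cases "tl p") (auto simp: end_col_def start_col_def butlast_append insert_commute)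

lemma start_col_rev: "length p \<ge> 2 \<Longrightarrow> start_col c (rev p) = end_col c p"
  using end_col_rev[of "rev p" c] by simp

lemma alt_path_append:
  assumes "p \<noteq> []" "q \<noteq> []"
  shows "alt_path E c (p @ q) \<longleftrightarrow>
    alt_path E c p \<and> alt_path E c q \<and> {last p, hd q} \<in> E \<and>
    (tl p \<noteq> [] \<longrightarrow> end_col c p \<noteq> c {last p, hd q}) \<and>
    (tl q \<noteq> [] \<longrightarrow> c {last p, hd q} \<noteq> start_col c q)"
  using assms
proof (induction E c p rule: alt_path.induct)
  case (1 E c x y p)
  then show ?case by (cases p; cases q; cases "tl q") auto
next
  case ("2_2" E c x)
  then show ?case by (cases q; cases "tl q") auto
qed simp_all

lemma alt_path_rev: "alt_path E c (rev p) \<longleftrightarrow> alt_path E c p"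
proof (induction E c p rule: alt_path.induct)
  case (1 E c x y p)
  show ?case
    using 1 alt_path_append[of "rev p @ [y]" "[x]" E c]
    by (cases p) (auto simp: end_col_snoc last_rev hd_rev insert_commute tl_append split: list.splits)
qed auto

text \<open>In contrast to \<open>alt_path_append\<close> the two lists overlap in one vertex, so no
  edge is added and the only new condition concerns the two colours at that vertex.\<close>

lemma alt_path_join:
  assumes "alt_path E c p" "alt_path E c q" "last p = hd q" "length p \<ge> 2" "length q \<ge> 2"
    "end_col c p \<noteq> start_col c q"
  shows "alt_path E c (p @ tl q)"
  using assms
proof (induction E c p rule: alt_path.induct)
  case (1 E c x y p)
  then show ?case by (cases p; cases q; cases "tl q") auto
qed auto

text \<open>The empty set is exempt because it is a subset of every part, and a colouring glued from
  two parts need not agree with both of them on it.\<close>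

lemma alt_path_cong:
  assumes "\<And>e. e \<subseteq> set p \<Longrightarrow> e \<noteq> {} \<Longrightarrow> c e = c' e"
  shows "alt_path E c p \<longleftrightarrow> alt_path E c' p"
  using assms
proof (induction E c p rule: alt_path.induct)
  case (1 E c x y p)
  have "alt_path E c (y # p) \<longleftrightarrow> alt_path E c' (y # p)"
    using 1 by (metis set_subset_Cons subset_trans)
  moreover have "c {x, y} = c' {x, y}" using 1(2) by simp
  moreover have "p \<noteq> [] \<Longrightarrow> c {y, hd p} = c' {y, hd p}" using 1(2) by (cases p) auto
  ultimately show ?case by auto
qed auto

lemma start_col_cong:
  assumes "\<And>e. e \<subseteq> set p \<Longrightarrow> e \<noteq> {} \<Longrightarrow> c e = c' e" "length p \<ge> 2"
  shows "start_col c p = start_col c' p"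
  using assms by (cases p; cases "tl p") auto

lemma end_col_cong:
  assumes "\<And>e. e \<subseteq> set p \<Longrightarrow> e \<noteq> {} \<Longrightarrow> c e = c' e" "length p \<ge> 2"
  shows "end_col c p = end_col c' p"
  using start_col_cong[of "rev p" c c'] assms by (simp add: start_col_rev)

lemma alt_path_comp_inj:
  "inj f \<Longrightarrow> alt_path E (f \<circ> c) p \<longleftrightarrow> alt_path E c p"
  by (induction E c p rule: alt_path.induct) (auto simp: inj_eq)

definition conn_path ::
    "'a set set \<Rightarrow> ('a set \<Rightarrow> 'c) \<Rightarrow> 'a set \<Rightarrow> 'a \<Rightarrow> 'a list \<Rightarrow> 'a \<Rightarrow> bool" where
  "conn_path E c W u p v \<longleftrightarrow>
     alt_path E c p \<and> distinct p \<and> set p \<subseteq> W \<and> p \<noteq> [] \<and> hd p = u \<and> last p = v"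

lemma conn_path_rev: "conn_path E c W u p v \<Longrightarrow> conn_path E c W v (rev p) u"
  unfolding conn_path_def by (auto simp: alt_path_rev hd_rev last_rev)

lemma conn_path_mono: "conn_path E c W u p v \<Longrightarrow> W \<subseteq> W' \<Longrightarrow> conn_path E c W' u p v"
  unfolding conn_path_def by auto

lemma conn_path_cong:
  assumes "\<And>e. e \<subseteq> W \<Longrightarrow> e \<noteq> {} \<Longrightarrow> c e = c' e" "conn_path E c W u p v"
  shows "conn_path E c' W u p v"
  using assms alt_path_cong[of p c c' E] unfolding conn_path_def by (meson subset_trans)

text \<open>The trivial path is excluded, since it has no end colours.\<close>

definition link ::
    "'a set set \<Rightarrow> ('a set \<Rightarrow> 'c) \<Rightarrow> 'a set \<Rightarrow> 'a \<Rightarrow> 'c \<Rightarrow> 'c \<Rightarrow> 'a \<Rightarrow> bool" where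
  "link E c W u s e v \<longleftrightarrow>
     (\<exists>p. conn_path E c W u p v \<and> length p \<ge> 2 \<and> start_col c p = s \<and> end_col c p = e)"

lemma link_sym: "link E c W u s e v \<Longrightarrow> link E c W v e s u"
  unfolding link_def by (metis conn_path_rev end_col_rev length_rev start_col_rev)

lemma link_mono: "link E c W u s e v \<Longrightarrow> W \<subseteq> W' \<Longrightarrow> link E c W' u s e v"
  unfolding link_def by (metis conn_path_mono)

lemma link_cong:
  assumes "\<And>e. e \<subseteq> W \<Longrightarrow> e \<noteq> {} \<Longrightarrow> c e = c' e" "link E c W u s e v"
  shows "link E c' W u s e v"
proof -
  obtain p where p: "conn_path E c W u p v" "length p \<ge> 2" "start_col c p = s" "end_col c p = e"
    using assms(2) unfolding link_def by blast
  have eq: "\<And>e. e \<subseteq> set p \<Longrightarrow> e \<noteq> {} \<Longrightarrow> c e = c' e"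
    using p(1) assms(1) unfolding conn_path_def by (meson subset_trans)
  show ?thesis
    unfolding link_def
    using p conn_path_cong[OF assms(1) p(1)] start_col_cong[of p c c', OF eq]
      end_col_cong[of p c c', OF eq] by auto
qed

section \<open>Strong colourings\<close>

text \<open>The two paths may share inner vertices. A single vertex is vacuously strong, which
  starts the ear construction.\<close>

definition strong :: "'a set set \<Rightarrow> ('a set \<Rightarrow> 'c) \<Rightarrow> 'a set \<Rightarrow> bool" where
  "strong E c W \<longleftrightarrow> (\<forall>u\<in>W. \<forall>v\<in>W. u \<noteq> v \<longrightarrow>
     (\<exists>s e s' e'. link E c W u s e v \<and> link E c W u s' e' v \<and> s \<noteq> s' \<and> e \<noteq> e'))"

lemma strong_cong:
  assumes "\<And>e. e \<subseteq> W \<Longrightarrow> e \<noteq> {} \<Longrightarrow> c e = c' e" "strong E c W"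
  shows "strong E c' W"
  using assms(2) link_cong[of W c c', OF assms(1)] unfolding strong_def by meson

text \<open>Follow the given path up to its first vertex in \<open>B\<close>; one of the two ways from there to \<open>w\<close>
  has a suitable first colour.\<close>

lemma link_into_strong:
  assumes B: "strong E c B" and l: "link E c A z s e x" and x: "x \<in> B" and z: "z \<notin> B"
    and w: "w \<in> B" "w \<notin> A"
  shows "\<exists>e'. link E c (A \<union> B) z s e' w"
proof -
  obtain p where p: "conn_path E c A z p x" "length p \<ge> 2" "start_col c p = s"
    using l unfolding link_def by blast
  have "\<exists>y\<in>set p. y \<in> B" using p(1) x unfolding conn_path_def by (metis last_in_set)
  then obtain p1 y p2 where sp: "p = p1 @ y # p2" "y \<in> B" "\<forall>a\<in>set p1. a \<notin> B"
    using split_list_first_prop[of p "\<lambda>a. a \<in> B"] by blast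
  have p1: "p1 \<noteq> []" using sp z p(1) unfolding conn_path_def by auto
  let ?p = "p1 @ [y]"
  have yA: "y \<in> A" using sp p(1) unfolding conn_path_def by auto
  have "alt_path E c ((p1 @ [y]) @ p2)" using p(1) sp unfolding conn_path_def by simp
  then have altp: "alt_path E c ?p"
    by (cases "p2 = []") (auto simp: alt_path_append simp del: append_assoc)
  have lenp: "length ?p \<ge> 2" using p1 by (cases p1) auto
  have "start_col c p = start_col c ?p" unfolding sp(1) using p1 by (simp add: start_col_append)
  then have sp': "start_col c ?p = s" using p(3) by simp
  \<comment> \<open>The vertex \<open>w\<close> lies outside \<open>A\<close>, while
    \<open>y\<close> is on a path inside \<open>A\<close>; hence \<open>strong\<close> applies to
    \<open>y\<close> and \<open>w\<close>.\<close>
  have "y \<noteq> w" using yA w by auto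
  then obtain s' e' where l': "link E c B y s' e' w" "s' \<noteq> end_col c ?p"
    using B sp(2) w(1) unfolding strong_def by metis
  then obtain q where q: "conn_path E c B y q w" "length q \<ge> 2" "start_col c q = s'" "end_col c q = e'"
    unfolding link_def by blast
  have qn: "q = y # tl q" "tl q \<noteq> []" using q(1,2) unfolding conn_path_def by (cases q; auto)+
  have "alt_path E c (?p @ tl q)"
    using alt_path_join[OF altp, of q] q l' lenp unfolding conn_path_def by auto
  moreover have "distinct (?p @ tl q)"
  proof -
    have "distinct q" "set q \<subseteq> B" using q(1) unfolding conn_path_def by auto
    moreover have "distinct ?p" using p(1) sp(1) unfolding conn_path_def by auto
    ultimately show ?thesis using sp(3) qn(1)
      by (metis (no_types, lifting) append.assoc append_Cons append_Nil disjoint_iff distinct_append subset_iff)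
  qed
  moreover have "set (?p @ tl q) \<subseteq> A \<union> B"
    using p(1) q(1) sp(1) qn unfolding conn_path_def by (auto dest: list.set_sel(2))
  moreover have "last (?p @ tl q) = w" using q(1) qn unfolding conn_path_def
    by (metis last_ConsR last_appendR)
  moreover have "hd (?p @ tl q) = z" using p(1) sp(1) p1 unfolding conn_path_def by simp
  ultimately have "conn_path E c (A \<union> B) z (?p @ tl q) w" unfolding conn_path_def by auto
  moreover have "start_col c (?p @ tl q) = s"
    using start_col_append[of ?p "tl q" c] p1 qn(2) sp' by (metis Nil_is_append_conv tl_append2 not_Cons_self2)
  moreover have "length (?p @ tl q) \<ge> 2" using lenp by simp
  ultimately show ?thesis unfolding link_def by blast
qed

text \<open>Entering \<open>B\<close> gives two ways from \<open>u\<close> to \<open>v\<close> with distinct first colours, and by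
  symmetry two with distinct last colours. Some pair among these four differs at both ends.\<close>

lemma strong_Un:
  assumes A: "strong E c A" and B: "strong E c B" and x: "x \<in> A" "x \<in> B"
  shows "strong E c (A \<union> B)"
proof -
  let ?L = "link E c (A \<union> B)"
  have mixed: "\<exists>s e s' e'. link E c (A \<union> B) u s e v \<and> link E c (A \<union> B) u s' e' v \<and> s \<noteq> s' \<and> e \<noteq> e'"
    if A: "strong E c A" and B: "strong E c B" and x: "x \<in> A" "x \<in> B"
      and u: "u \<in> A" "u \<notin> B" and v: "v \<in> B" "v \<notin> A" for A B u v
  proof -
    obtain s1 e1 s2 e2 where "link E c A u s1 e1 x" "link E c A u s2 e2 x" and s: "s1 \<noteq> s2"
      using A x u unfolding strong_def by metis
    then obtain a1 a2 where a: "link E c (A \<union> B) u s1 a1 v" "link E c (A \<union> B) u s2 a2 v"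
      using link_into_strong[OF B] x u v by metis
    obtain t1 f1 t2 f2 where "link E c B v t1 f1 x" "link E c B v t2 f2 x" and t: "t1 \<noteq> t2"
      using B x v unfolding strong_def by metis
    then obtain b1 b2 where "link E c (A \<union> B) v t1 b1 u" "link E c (A \<union> B) v t2 b2 u"
      using link_into_strong[OF A] x u v by (metis Un_commute)
    then have b: "link E c (A \<union> B) u b1 t1 v" "link E c (A \<union> B) u b2 t2 v"
      by (auto intro: link_sym)
    \<comment> \<open>If \<open>a1 \<noteq> a2\<close> or \<open>b1 \<noteq> b2\<close>, that pair
      will do. Otherwise one of \<open>s1\<close>, \<open>s2\<close> differs from \<open>b1\<close>
      and one of \<open>t1\<close>, \<open>t2\<close> differs from \<open>a1\<close>; the two paths
      belonging to them differ at both ends.\<close>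
    show ?thesis using a b s t by metis
  qed
  show ?thesis
    unfolding strong_def
  proof (intro ballI impI)
    fix u v assume u: "u \<in> A \<union> B" and v: "v \<in> A \<union> B" and uv: "u \<noteq> v"
    consider "u \<in> A" "v \<in> A" | "u \<in> B" "v \<in> B" | "u \<in> A" "u \<notin> B" "v \<in> B" "v \<notin> A"
      | "u \<in> B" "u \<notin> A" "v \<in> A" "v \<notin> B" using u v by auto
    then show "\<exists>s e s' e'. ?L u s e v \<and> ?L u s' e' v \<and> s \<noteq> s' \<and> e \<noteq> e'"
    proof cases
      case 1
      then show ?thesis using A uv unfolding strong_def by (meson Un_upper1 link_mono)
    next
      case 2
      then show ?thesis using B uv unfolding strong_def by (meson Un_upper2 link_mono)
    next
      case 3
      then show ?thesis using mixed[OF A B x] by blast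
    next
      case 4
      then show ?thesis using mixed[OF B A x(2,1)] by (simp add: Un_commute)
    qed
  qed
qed

section \<open>Properly coloured cycles\<close>

definition alt_cycle :: "'a set set \<Rightarrow> ('a set \<Rightarrow> 'c) \<Rightarrow> 'a list \<Rightarrow> bool" where
  "alt_cycle E c p \<longleftrightarrow> alt_path E c p \<and> distinct p \<and> length p \<ge> 3 \<and> {last p, hd p} \<in> E \<and>
     c {last p, hd p} \<noteq> start_col c p \<and> c {last p, hd p} \<noteq> end_col c p"

text \<open>The closing edge and the edge between \<open>p\<close> and \<open>q\<close> exchange
  their roles.\<close>

lemma alt_cycle_swap:
  assumes "alt_cycle E c (p @ q)"
  shows "alt_cycle E c (q @ p)"
proof (cases "p = [] \<or> q = []")
  case False
  then have ne: "p \<noteq> []" "q \<noteq> []" by auto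
  have "length p \<ge> 2 \<or> length q \<ge> 2" using assms ne unfolding alt_cycle_def by (cases p; cases q) (auto simp: Suc_le_eq)
  then have "tl p \<noteq> [] \<or> tl q \<noteq> []" by (cases p; cases q) auto
  moreover have "tl p = [] \<Longrightarrow> last p = hd p" "tl q = [] \<Longrightarrow> last q = hd q"
    using ne by (cases p; cases q; auto)+
  ultimately show ?thesis
    using assms ne unfolding alt_cycle_def
    by (auto simp: alt_path_append start_col_append end_col_append insert_commute split: if_splits)
next
  case True
  then show ?thesis using assms by auto
qed

text \<open>The two paths are the two arcs between \<open>u\<close> and \<open>v\<close>: at each
  end they use adjacent edges of the cycle, which have distinct colours.\<close>

lemma strong_alt_cycle:
  assumes "alt_cycle E c p"
  shows "strong E c (set p)"
  unfolding strong_def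
proof (intro ballI impI)
  fix u v assume u: "u \<in> set p" and v: "v \<in> set p" and uv: "u \<noteq> v"
  obtain p1 p2 where "p = p1 @ u # p2" using u by (meson split_list)
  then have cyc: "alt_cycle E c (u # p2 @ p1)" and st: "set p = set (u # p2 @ p1)"
    using alt_cycle_swap[of E c p1 "u # p2"] assms by auto
  then obtain r1 r2 where r: "p2 @ p1 = r1 @ v # r2"
    using v uv by (metis set_ConsD split_list)
  then have cyc: "alt_cycle E c ((u # r1) @ v # r2)" and st: "set p = set (u # r1 @ v # r2)"
    using cyc st by auto
  have cyc2: "alt_cycle E c ((v # r2) @ (u # r1))" using alt_cycle_swap[OF cyc] .
  \<comment> \<open>A cycle has at least three vertices, so the arcs are not both the single edge
    between \<open>u\<close> and \<open>v\<close>.\<close>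
  have ne: "r1 \<noteq> [] \<or> r2 \<noteq> []" using cyc unfolding alt_cycle_def by auto
  let ?p = "u # r1 @ [v]" and ?q = "v # r2 @ [u]"
  have "alt_path E c (?p @ r2)" using cyc unfolding alt_cycle_def by simp
  then have ap: "alt_path E c ?p"
    by (cases "r2 = []") (simp_all add: alt_path_append del: append.simps append_assoc)
  have "alt_path E c (?q @ r1)" using cyc2 unfolding alt_cycle_def by simp
  then have aq: "alt_path E c ?q"
    by (cases "r1 = []") (simp_all add: alt_path_append del: append.simps append_assoc)
  have "conn_path E c (set p) u ?p v" using ap cyc unfolding conn_path_def st alt_cycle_def by auto
  then have l1: "link E c (set p) u (start_col c ?p) (end_col c ?p) v"
    unfolding link_def by (intro exI[of _ ?p]) auto
  have "conn_path E c (set p) v ?q u" using aq cyc unfolding conn_path_def st alt_cycle_def by auto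
  then have "link E c (set p) v (start_col c ?q) (end_col c ?q) u"
    unfolding link_def by (intro exI[of _ ?q]) auto
  then have l2: "link E c (set p) u (end_col c ?q) (start_col c ?q) v" by (rule link_sym)
  have n1: "start_col c ?p \<noteq> end_col c ?q"
    using cyc ne unfolding alt_cycle_def
    by (cases r1; cases r2 rule: rev_cases)
      (auto simp: start_col_append end_col_append end_col_snoc insert_commute split: if_splits)
  have n2: "end_col c ?p \<noteq> start_col c ?q"
    using cyc2 ne unfolding alt_cycle_def
    by (cases r2; cases r1 rule: rev_cases)
      (auto simp: start_col_append end_col_append end_col_snoc insert_commute split: if_splits)
  show "\<exists>s e s' e'. link E c (set p) u s e v \<and> link E c (set p) u s' e' v \<and> s \<noteq> s' \<and> e \<noteq> e'"
    using l1 l2 n1 n2 by blast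
qed

section \<open>Strong three-colourings of graphs without bridges\<close>

text \<open>Connectedness of the subgraph induced on \<open>V\<close>, phrased by cuts: this form
  suits the deletion of an edge and needs no paths.\<close>

definition cut_connected :: "'a set set \<Rightarrow> 'a set \<Rightarrow> bool" where
  "cut_connected E V \<longleftrightarrow> V \<noteq> {} \<and>
     (\<forall>S. S \<subseteq> V \<and> S \<noteq> {} \<and> S \<noteq> V \<longrightarrow> (\<exists>x\<in>S. \<exists>y\<in>V - S. {x, y} \<in> E))"

text \<open>The set \<open>e\<close> need not be an edge, so connectedness itself is
  included.\<close>

definition bridgeless :: "'a set set \<Rightarrow> 'a set \<Rightarrow> bool" where
  "bridgeless E V \<longleftrightarrow> (\<forall>e. cut_connected (E - {e}) V)"

lemma cut_connectedD:
  assumes "cut_connected E V" "S \<subseteq> V" "S \<noteq> {}" "S \<noteq> V"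
  obtains x y where "x \<in> S" "y \<in> V" "y \<notin> S" "{x, y} \<in> E"
  using assms unfolding cut_connected_def by blast

text \<open>Take an edge from \<open>x\<close> in \<open>W\<close> to \<open>y\<close> outside, and
  let \<open>S\<close> be the set of vertices reached from \<open>y\<close> outside
  \<open>W\<close>. As this edge is no bridge, another edge leaves \<open>S\<close>; its far end
  must be in \<open>W\<close>, or else it would belong to \<open>S\<close>. The ear may be closed,
  with \<open>t = x\<close>.\<close>

lemma obtain_ear:
  assumes V: "bridgeless E V" and W: "W \<subseteq> V" "W \<noteq> {}" "W \<noteq> V"
  obtains x q t where "x \<in> W" "q \<noteq> []" "distinct q" "set q \<subseteq> V - W"
    "successively (\<lambda>a b. {a, b} \<in> E) q" "{x, hd q} \<in> E" "t \<in> W" "{last q, t} \<in> E"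
    "{last q, t} \<noteq> {x, hd q}"
proof -
  have "cut_connected (E - {{}}) V" using V unfolding bridgeless_def by blast
  then obtain x y where xy: "x \<in> W" "y \<in> V" "y \<notin> W" "{x, y} \<in> E"
    using cut_connectedD[of _ V W] W by (metis DiffD1)
  define Q where "Q s q \<longleftrightarrow> q \<noteq> [] \<and> hd q = y \<and> last q = s \<and> distinct q \<and> set q \<subseteq> V - W \<and>
    successively (\<lambda>a b. {a, b} \<in> E) q" for s q
  define S where "S = {s. \<exists>q. Q s q}"
  have "Q y [y]" using xy unfolding Q_def by auto
  then have yS: "y \<in> S" unfolding S_def by blast
  have SV: "S \<subseteq> V - W" unfolding S_def Q_def by (auto dest: last_in_set)
  have "cut_connected (E - {{x, y}}) V" using V unfolding bridgeless_def by blast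
  moreover have "S \<noteq> {}" "S \<noteq> V" "S \<subseteq> V" using yS SV W by auto
  ultimately obtain s t where st: "s \<in> S" "t \<in> V" "t \<notin> S" "{s, t} \<in> E - {{x, y}}"
    by (meson cut_connectedD)
  obtain q where q: "Q s q" using st unfolding S_def by blast
  have "t \<in> W"
  proof (rule ccontr)
    assume tW: "t \<notin> W"
    have "t \<notin> set q"
    proof
      assume "t \<in> set q"
      then obtain q1 q2 where sp: "q = q1 @ t # q2" by (meson split_list)
      then have "q = (q1 @ [t]) @ q2" by simp
      then have "successively (\<lambda>a b. {a, b} \<in> E) (q1 @ [t])"
        using q unfolding Q_def by (metis successively_append_iff)
      then have "Q t (q1 @ [t])" using q sp unfolding Q_def by (cases q1) auto
      then show False using st(3) unfolding S_def by blast
    qed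
    then have "Q t (q @ [t])"
      using q st tW unfolding Q_def by (auto simp: successively_append_iff)
    then show False using st(3) unfolding S_def by blast
  qed
  then show ?thesis using that[of x q t] xy q st unfolding Q_def by auto
qed

text \<open>The source of the three colours: the closing edge of a cycle has two neighbours on
  it.\<close>

lemma colour_avoiding_two: "\<exists>d<3. d \<noteq> a \<and> d \<noteq> (b::nat)"
  by presburger

lemma extend_alt_path:
  fixes c :: "'a set \<Rightarrow> nat"
  assumes "alt_path E c p" "p \<noteq> []" "distinct (p @ q)" "\<forall>e. c e < 3"
    "successively (\<lambda>a b. {a, b} \<in> E) (last p # q)"
  shows "\<exists>c'. (\<forall>e. c' e < 3) \<and> (\<forall>e. e \<inter> set q = {} \<longrightarrow> c' e = c e) \<and> alt_path E c' (p @ q)"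
  using assms
proof (induction q rule: rev_induct)
  case (snoc z q)
  have suc: "successively (\<lambda>a b. {a, b} \<in> E) (last p # q)" "{last (p @ q), z} \<in> E"
    using snoc.prems(5) successively_append_iff[of _ "last p # q" "[z]"]
    by (auto split: if_splits)
  then obtain c' where c': "\<forall>e. c' e < 3" "\<forall>e. e \<inter> set q = {} \<longrightarrow> c' e = c e" "alt_path E c' (p @ q)"
    using snoc by auto
  let ?r = "p @ q"
  \<comment> \<open>Only the preceding edge has to be avoided. If \<open>?r\<close> is a single
    vertex, its \<open>end_col\<close> is junk, but avoiding it does no harm.\<close>
  obtain d where d: "d < 3" "d \<noteq> end_col c' ?r" using colour_avoiding_two by blast
  let ?c = "c'({last ?r, z} := d)"
  have z: "z \<notin> set ?r" using snoc.prems(3) by auto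
  then have eq: "\<And>e. e \<subseteq> set ?r \<Longrightarrow> e \<noteq> {} \<Longrightarrow> c' e = ?c e" by auto
  have "alt_path E ?c ?r" using alt_path_cong[of ?r c' ?c, OF eq] c'(3) by blast
  moreover have "end_col ?c ?r \<noteq> d" if "tl ?r \<noteq> []"
  proof -
    have "length ?r \<ge> 2" using that by (cases ?r; cases "tl ?r") auto
    then show ?thesis using end_col_cong[of ?r c' ?c, OF eq] d by simp
  qed
  ultimately have "alt_path E ?c (?r @ [z])"
    using suc snoc.prems(2) by (subst alt_path_append) auto
  moreover have "\<forall>e. e \<inter> set (q @ [z]) = {} \<longrightarrow> ?c e = c e" using c' by auto
  moreover have "\<forall>e. ?c e < 3" using c' d by auto
  ultimately show ?case by (metis append_assoc)
qed auto

lemma recolour_closing_edge: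
  assumes r: "distinct r" "length r \<ge> 3" and c: "\<And>e. e \<noteq> {last r, hd r} \<Longrightarrow> c e = c' e"
  shows "alt_path E c r \<longleftrightarrow> alt_path E c' r" "start_col c r = start_col c' r"
    "end_col c r = end_col c' r"
proof -
  \<comment> \<open>The closing edge is a subset of \<open>set r\<close>, so the congruence rules
    apply only after the last vertex is split off; with three distinct vertices the closing edge is
    not the last edge of the path either.\<close>
  obtain p z where p: "r = p @ [z]" "length p \<ge> 2" using r(2) by (cases r rule: rev_cases) auto
  have ne: "p \<noteq> []" "tl p \<noteq> []" using p(2) by (cases p; cases "tl p"; auto)+
  have hdl: "hd p \<noteq> last p" using ne r(1) p(1) by (cases p) auto
  have eq: "c e = c' e" if "e \<subseteq> set p" "e \<noteq> {}" for e
    using that c[of e] p r(1) by auto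
  have "last p \<noteq> z" using last_in_set[OF ne(1)] r(1) p(1) by auto
  then have eqz: "c {last p, z} = c' {last p, z}"
    using c[of "{last p, z}"] p ne hdl r(1) by (auto simp: doubleton_eq_iff)
  show "alt_path E c r \<longleftrightarrow> alt_path E c' r"
    using alt_path_cong[of p c c' E, OF eq] end_col_cong[of p c c', OF eq p(2)] eqz ne p(1)
    by (simp add: alt_path_append)
  show "start_col c r = start_col c' r"
    using start_col_cong[of p c c', OF eq p(2)] ne p(1) by (simp add: start_col_append)
  show "end_col c r = end_col c' r" using eqz ne p(1) by (simp add: end_col_snoc)
qed

text \<open>An ear is closed up to a properly coloured cycle by a proper path inside \<open>W\<close>.\<close>

lemma strong_extend:
  fixes c :: "'a set \<Rightarrow> nat"
  assumes V: "bridgeless E V" and W: "W \<subseteq> V" "W \<noteq> {}" "W \<noteq> V"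
    and c: "strong E c W" "\<forall>e. c e < 3"
  obtains W' and c' :: "'a set \<Rightarrow> nat" where "W \<subset> W'" "W' \<subseteq> V" "strong E c' W'" "\<forall>e. c' e < 3"
proof -
  obtain x q t where q: "x \<in> W" "q \<noteq> []" "distinct q" "set q \<subseteq> V - W"
    "successively (\<lambda>a b. {a, b} \<in> E) q" "{x, hd q} \<in> E" and t: "t \<in> W" "{last q, t} \<in> E"
    "{last q, t} \<noteq> {x, hd q}"
    using obtain_ear[OF V W] by metis
  \<comment> \<open>The path runs from \<open>t\<close> to \<open>x\<close>, so that
    \<open>p @ q\<close> continues along the ear and \<open>{last q, t}\<close> closes the
    cycle.\<close>
  have "\<exists>p. conn_path E c W t p x"
  proof (cases "t = x")
    case True
    then have "conn_path E c W t [x] x" using q unfolding conn_path_def by simp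
    then show ?thesis by blast
  next
    case False
    then show ?thesis using c(1) q t unfolding strong_def link_def by metis
  qed
  then obtain p where p: "conn_path E c W t p x" by blast
  have pp: "p \<noteq> []" "hd p = t" "last p = x" "distinct p" "set p \<subseteq> W" "alt_path E c p"
    using p unfolding conn_path_def by auto
  have dist: "distinct (p @ q)" using pp q by auto
  have "successively (\<lambda>a b. {a, b} \<in> E) (last p # q)" using q pp by (cases q) auto
  then obtain c1 where c1: "\<forall>e. c1 e < 3" "\<forall>e. e \<inter> set q = {} \<longrightarrow> c1 e = c e"
    "alt_path E c1 (p @ q)"
    using extend_alt_path[OF pp(6,1) dist c(2)] by auto
  let ?r = "p @ q" and ?f = "{last q, t}"
  have len: "length ?r \<ge> 3"
  proof (cases "tl p = []")
    case True
    then have "p = [x]" "t = x" using pp by (cases p; auto)+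
    \<comment> \<open>A closed ear has two distinct end edges at \<open>x\<close>, hence at least
      two vertices outside \<open>W\<close>.\<close>
    then have "tl q \<noteq> []" using t(3) q(2) by (cases q) (auto simp: insert_commute)
    then show ?thesis using \<open>p = [x]\<close> by (cases q; cases "tl q") auto
  next
    case False
    then show ?thesis using q(2) by (cases p; cases "tl p"; cases q) auto
  qed
  obtain d where d: "d < 3" "d \<noteq> start_col c1 ?r" "d \<noteq> end_col c1 ?r"
    using colour_avoiding_two by metis
  let ?c = "c1(?f := d)"
  have hl: "hd ?r = t" "last ?r = last q" using pp q by auto
  have "alt_path E ?c ?r" "start_col ?c ?r = start_col c1 ?r" "end_col ?c ?r = end_col c1 ?r"
    using recolour_closing_edge[OF dist len, of ?c c1] c1(3) hl by auto
  then have cyc: "alt_cycle E ?c ?r"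
    unfolding alt_cycle_def using dist len hl t d by auto
  \<comment> \<open>All changes of colour concern sets that meet the ear, so \<open>W\<close>
    remains strong.\<close>
  have "last q \<notin> W" using last_in_set[OF q(2)] q(4) by auto
  then have eq: "c e = ?c e" if "e \<subseteq> W" for e
  proof -
    have "e \<inter> set q = {}" "e \<noteq> {last q, t}" using that q(4) \<open>last q \<notin> W\<close> by auto
    then show ?thesis using c1(2) by simp
  qed
  have "strong E ?c W"
    using strong_cong[of W c ?c E] eq c(1) by blast
  then have "strong E ?c (W \<union> set ?r)"
    using strong_Un[of E ?c W "set ?r" x] strong_alt_cycle[OF cyc] q(1) pp(1,3)
    by (metis Un_iff last_in_set set_append)
  moreover have "W \<subset> W \<union> set ?r" using last_in_set[OF q(2)] \<open>last q \<notin> W\<close> by auto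
  moreover have "W \<union> set ?r \<subseteq> V" using W q pp by auto
  moreover have "\<forall>e. ?c e < 3" using c1 d by auto
  ultimately show ?thesis by (intro that[of "W \<union> set ?r" ?c])
qed

text \<open>Start from a single vertex; every extension covers a further vertex, so the process ends
  with \<open>V\<close>.\<close>

lemma bridgeless_strong:
  assumes "finite V" "bridgeless E V"
  obtains c :: "'a set \<Rightarrow> nat" where "strong E c V" "\<forall>e. c e < 3"
proof -
  have "V \<noteq> {}" using assms(2) unfolding bridgeless_def cut_connected_def by blast
  then obtain v where v: "v \<in> V" by blast
  have "\<exists>c. strong E c V \<and> (\<forall>e. c e < (3::nat))"
    if "W \<subseteq> V" "W \<noteq> {}" "strong E c W" "\<forall>e. c e < (3::nat)" for W c
    using that
  proof (induction "card (V - W)" arbitrary: W c rule: less_induct)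
    case less
    show ?case
    proof (cases "W = V")
      case False
      then obtain W' c' where W': "W \<subset> W'" "W' \<subseteq> V" "strong E c' W'" "\<forall>e. c' e < (3::nat)"
        using strong_extend[OF assms(2) less.prems(1,2) False less.prems(3,4)] by metis
      moreover have "card (V - W') < card (V - W)"
        using W' assms(1) by (intro psubset_card_mono) auto
      ultimately show ?thesis using less.hyps[of W' c'] by auto
    qed (use less in auto)
  qed
  from this[of "{v}" "\<lambda>_. 0"] show ?thesis using that v unfolding strong_def by auto
qed

section \<open>Gluing along bridges\<close>

text \<open>A mark \<open>(x, i)\<close> with colour \<open>a\<close> stands for a further edge of colour \<open>a\<close> attached at \<open>x\<close>,
  the label \<open>i\<close> keeping several marks at the same vertex apart. The sets \<open>X\<close> and \<open>Y\<close>, empty or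
  the singleton colour of a mark, are the colours that the path must avoid at its two ends;
  the path of length zero joins two marks of distinct colours.\<close>

definition reach ::
    "'a set set \<Rightarrow> ('a set \<Rightarrow> 'c) \<Rightarrow> 'a set \<Rightarrow> 'a \<Rightarrow> 'c set \<Rightarrow> 'c set \<Rightarrow> 'a \<Rightarrow> bool" where
  "reach E c W u X Y v \<longleftrightarrow> (\<exists>p. conn_path E c W u p v \<and>
     (if tl p = [] then X \<inter> Y = {} else start_col c p \<notin> X \<and> end_col c p \<notin> Y))"

lemma reach_refl: "u \<in> W \<Longrightarrow> X \<inter> Y = {} \<Longrightarrow> reach E c W u X Y u"
  unfolding reach_def conn_path_def by (intro exI[of _ "[u]"]) auto

lemma tl_conv_length: "tl p = [] \<longleftrightarrow> \<not> length p \<ge> 2"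
  by (cases p; cases "tl p") auto

lemma reach_link: "link E c W u s e v \<Longrightarrow> s \<notin> X \<Longrightarrow> e \<notin> Y \<Longrightarrow> reach E c W u X Y v"
  unfolding reach_def link_def by (auto simp: tl_conv_length)

lemma reach_sym: "reach E c W u X Y v \<Longrightarrow> reach E c W v Y X u"
  unfolding reach_def tl_conv_length
  by (metis conn_path_rev end_col_rev inf_commute length_rev start_col_rev)

lemma reach_mono: "reach E c W u X Y v \<Longrightarrow> W \<subseteq> W' \<Longrightarrow> reach E c W' u X Y v"
  unfolding reach_def by (metis conn_path_mono)

lemma reach_cong:
  assumes "\<And>e. e \<subseteq> W \<Longrightarrow> e \<noteq> {} \<Longrightarrow> c e = c' e" "reach E c W u X Y v"
  shows "reach E c' W u X Y v"
proof -
  obtain p where p: "conn_path E c W u p v"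
    "if tl p = [] then X \<inter> Y = {} else start_col c p \<notin> X \<and> end_col c p \<notin> Y"
    using assms(2) unfolding reach_def by blast
  have eq: "\<And>e. e \<subseteq> set p \<Longrightarrow> e \<noteq> {} \<Longrightarrow> c e = c' e"
    using p(1) assms(1) unfolding conn_path_def by (meson subset_trans)
  show ?thesis
    unfolding reach_def
    using p conn_path_cong[OF assms(1) p(1)] start_col_cong[of p c c', OF eq]
      end_col_cong[of p c c', OF eq] by (intro exI[of _ p]) (auto simp: tl_conv_length)
qed

text \<open>This permits the colours of one part to be permuted before gluing.\<close>

lemma reach_comp_inj:
  assumes "inj f" "reach E c W u X Y v"
  shows "reach E (f \<circ> c) W u (f ` X) (f ` Y) v"
proof -
  obtain p where p: "conn_path E c W u p v"
    "if tl p = [] then X \<inter> Y = {} else start_col c p \<notin> X \<and> end_col c p \<notin> Y"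
    using assms(2) unfolding reach_def by blast
  have "conn_path E (f \<circ> c) W u p v"
    using p(1) alt_path_comp_inj[OF assms(1)] unfolding conn_path_def by blast
  moreover have "start_col (f \<circ> c) p = f (start_col c p)" "end_col (f \<circ> c) p = f (end_col c p)"
    by (simp_all add: start_col_def end_col_def)
  moreover have "f ` X \<inter> f ` Y = {}" if "X \<inter> Y = {}"
    using that assms(1) by (simp flip: image_Int)
  ultimately show ?thesis
    unfolding reach_def using p(2) assms(1)
    by (intro exI[of _ p]) (auto simp: inj_image_mem_iff)
qed

text \<open>If one of the two paths is trivial, the bridge becomes the first or last edge, and the
  convention of \<open>reach\<close> for trivial paths says exactly that its colour is allowed
  there.\<close>

lemma reach_glue:
  assumes u: "reach E c A u X {c {x, y}} x" and v: "reach E c B y {c {x, y}} Y v"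
    and AB: "A \<inter> B = {}" and xy: "{x, y} \<in> E"
  shows "reach E c (A \<union> B) u X Y v"
proof -
  obtain p where p: "conn_path E c A u p x" "if tl p = [] then X \<inter> {c {x, y}} = {}
      else start_col c p \<notin> X \<and> end_col c p \<notin> {c {x, y}}"
    using u unfolding reach_def by blast
  obtain q where q: "conn_path E c B y q v" "if tl q = [] then {c {x, y}} \<inter> Y = {}
      else start_col c q \<notin> {c {x, y}} \<and> end_col c q \<notin> Y"
    using v unfolding reach_def by blast
  have ne: "p \<noteq> []" "q \<noteq> []" using p q unfolding conn_path_def by auto
  have pq: "last p = x" "hd q = y" "tl p = [] \<Longrightarrow> hd p = x" "tl q = [] \<Longrightarrow> last q = y"
    using p q unfolding conn_path_def by (cases p; cases q; auto)+
  have "conn_path E c (A \<union> B) u (p @ q) v"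
    using p q ne AB xy unfolding conn_path_def
    by (auto simp: alt_path_append split: if_splits)
  moreover have "start_col c (p @ q) \<notin> X"
    using p(2) ne pq by (auto simp: start_col_append split: if_splits)
  moreover have "end_col c (p @ q) \<notin> Y"
    using q(2) ne pq by (auto simp: end_col_append split: if_splits)
  moreover have "tl (p @ q) \<noteq> []" using ne by (cases p) auto
  ultimately show ?thesis unfolding reach_def by (intro exI[of _ "p @ q"]) auto
qed

text \<open>The invariant for gluing: marks are stubs of bridges still to be added. Two marks at the
  same vertex have distinct colours, because only the trivial path joins a vertex to itself.\<close>

definition marked_colouring :: "'a set set \<Rightarrow> nat \<Rightarrow> 'a set \<Rightarrow> ('a \<times> nat) set \<Rightarrow>
    ('a set \<Rightarrow> nat) \<Rightarrow> ('a \<times> nat \<Rightarrow> nat) \<Rightarrow> bool" where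
  "marked_colouring E k V M c a \<longleftrightarrow>
     (\<forall>e. c e < k) \<and> (\<forall>\<mu>\<in>M. a \<mu> < k) \<and>
     (\<forall>u\<in>V. \<forall>v\<in>V. reach E c V u {} {} v) \<and>
     (\<forall>\<mu>\<in>M. \<forall>v\<in>V. reach E c V (fst \<mu>) {a \<mu>} {} v) \<and>
     (\<forall>\<mu>\<in>M. \<forall>\<nu>\<in>M. \<mu> \<noteq> \<nu> \<longrightarrow> reach E c V (fst \<mu>) {a \<mu>} {a \<nu>} (fst \<nu>))"

lemma strong_reach:
  assumes "strong E c V" "u \<in> V" "v \<in> V"
  shows "reach E c V u {} {} v" "reach E c V u {s} {} v"
    "\<exists>b. \<forall>b'. b' \<noteq> b \<longrightarrow> reach E c V u {s} {b'} v"
proof -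
  have "reach E c V u {} {} v \<and> reach E c V u {s} {} v \<and>
    (\<exists>b. \<forall>b'. b' \<noteq> b \<longrightarrow> reach E c V u {s} {b'} v)"
  proof (cases "u = v")
    case True
    then have "\<forall>b'. b' \<noteq> s \<longrightarrow> reach E c V u {s} {b'} v"
      using assms reach_refl[of u V _ _ E c] by auto
    then have "\<exists>b. \<forall>b'. b' \<noteq> b \<longrightarrow> reach E c V u {s} {b'} v" by blast
    then show ?thesis using True assms reach_refl[of u V _ _ E c] by auto
  next
    case False
    then obtain s1 e1 s2 e2 where l: "link E c V u s1 e1 v" "link E c V u s2 e2 v" "s1 \<noteq> s2" "e1 \<noteq> e2"
      using assms unfolding strong_def by metis
    \<comment> \<open>One of the two links does not start with \<open>s\<close>; only its last
      colour is ruled out for \<open>b'\<close>.\<close>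
    then have "reach E c V u {s} {b'} v" if "b' \<noteq> (if s = s1 then e2 else e1)" for b'
      using that reach_link[OF l(1), of "{s}" "{b'}"] reach_link[OF l(2), of "{s}" "{b'}"]
      by (auto split: if_splits)
    moreover have "reach E c V u {} {} v" using reach_link[OF l(1)] by blast
    moreover have "reach E c V u {s} {} v"
      using reach_link[OF l(1), of "{s}" "{}"] reach_link[OF l(2), of "{s}" "{}"] l(3) by auto
    ultimately show ?thesis by blast
  qed
  then show "reach E c V u {} {} v" "reach E c V u {s} {} v"
    "\<exists>b. \<forall>b'. b' \<noteq> b \<longrightarrow> reach E c V u {s} {b'} v" by blast+
qed

text \<open>The marks are coloured greedily: each earlier mark rules out at most one colour.\<close>

lemma strong_marked_colouring:
  assumes c: "strong E c V" "\<forall>e. c e < k" and M: "finite M" "fst ` M \<subseteq> V" "card M \<le> k"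
  shows "\<exists>a. marked_colouring E k V M c a"
  using M
proof (induction M rule: finite_induct)
  case empty
  then show ?case using c strong_reach(1)[OF c(1)] unfolding marked_colouring_def by auto
next
  case (insert \<mu> M)
  then obtain a where a: "marked_colouring E k V M c a" by auto
  have muV: "fst \<mu> \<in> V" and MV: "\<And>\<nu>. \<nu> \<in> M \<Longrightarrow> fst \<nu> \<in> V" using insert.prems by auto
  have "\<forall>\<nu>\<in>M. \<exists>b. \<forall>b'. b' \<noteq> b \<longrightarrow> reach E c V (fst \<nu>) {a \<nu>} {b'} (fst \<mu>)"
    using strong_reach(3)[OF c(1)] MV muV by blast
  then obtain f where f: "\<And>\<nu> b'. \<nu> \<in> M \<Longrightarrow> b' \<noteq> f \<nu> \<Longrightarrow> reach E c V (fst \<nu>) {a \<nu>} {b'} (fst \<mu>)"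
    by metis
  \<comment> \<open>The new mark counts in the bound \<open>k\<close>, so fewer than
    \<open>k\<close> marks precede it.\<close>
  have "card (f ` M) < card {..<k}"
    using card_image_le[OF insert.hyps(1), of f] insert.prems insert.hyps by simp
  then obtain b where b: "b < k" "b \<notin> f ` M"
    by (metis card_mono finite_imageI insert.hyps(1) lessThan_iff not_less subsetI)
  let ?a = "a(\<mu> := b)"
  have new: "reach E c V (fst \<nu>) {a \<nu>} {b} (fst \<mu>)" if "\<nu> \<in> M" for \<nu>
    using f[OF that, of b] b(2) that by blast
  have "marked_colouring E k V (insert \<mu> M) c ?a"
    using a b(1) insert.hyps(2) new reach_sym[OF new] strong_reach(2)[OF c(1) muV]
    unfolding marked_colouring_def by auto
  then show ?case by blast
qed

lemma marked_colouringD: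
  assumes "marked_colouring E k V M c a"
  shows "c e < k" "\<mu> \<in> M \<Longrightarrow> a \<mu> < k"
    "u \<in> V \<Longrightarrow> v \<in> V \<Longrightarrow> reach E c V u {} {} v"
    "\<mu> \<in> M \<Longrightarrow> v \<in> V \<Longrightarrow> reach E c V (fst \<mu>) {a \<mu>} {} v"
    "\<mu> \<in> M \<Longrightarrow> \<nu> \<in> M \<Longrightarrow> \<mu> \<noteq> \<nu> \<Longrightarrow> reach E c V (fst \<mu>) {a \<mu>} {a \<nu>} (fst \<nu>)"
  using assms unfolding marked_colouring_def by blast+

text \<open>The bridge appears as an additional mark on either side. Swapping two colours throughout
  \<open>B\<close> makes the colours of these marks agree, and the common colour is given to the
  bridge. A path between the sides is composed at the bridge by \<open>reach_glue\<close>.\<close>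

lemma marked_colouring_glue:
  assumes A: "marked_colouring E k A (insert (x, n) {\<mu> \<in> M. fst \<mu> \<in> A}) cA aA"
    and B: "marked_colouring E k B (insert (y, n) {\<mu> \<in> M. fst \<mu> \<in> B}) cB aB"
    and n: "n \<notin> snd ` M" and M: "fst ` M \<subseteq> A \<union> B"
    and AB: "A \<inter> B = {}" and xy: "x \<in> A" "y \<in> B" "{x, y} \<in> E"
  shows "\<exists>c a. marked_colouring E k (A \<union> B) M c a"
proof -
  define s where "s = aA (x, n)"
  define t where "t = aB (y, n)"
  define \<pi> where "\<pi> i = (if i = s then t else if i = t then s else i)" for i
  have inj: "inj \<pi>" unfolding inj_def \<pi>_def by auto
  have pt: "\<pi> t = s" by (simp add: \<pi>_def)
  have st: "s < k" "t < k" unfolding s_def t_def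
    using marked_colouringD(2)[OF A, of "(x, n)"] marked_colouringD(2)[OF B, of "(y, n)"] by simp_all
  have pk: "i < k \<Longrightarrow> \<pi> i < k" for i using st by (simp add: \<pi>_def)
  \<comment> \<open>Sets contained in neither part, other than the bridge, get an arbitrary colour
    below \<open>k\<close>; no path built here uses them.\<close>
  define c where "c e = (if e = {x, y} then s else if e \<subseteq> A then cA e else \<pi> (cB e))" for e
  define a where "a \<mu> = (if fst \<mu> \<in> A then aA \<mu> else \<pi> (aB \<mu>))" for \<mu>
  have cxy: "c {x, y} = s" by (simp add: c_def)
  have cA: "cA e = c e" if "e \<subseteq> A" "e \<noteq> {}" for e using that xy AB unfolding c_def by auto
  have cB: "(\<pi> \<circ> cB) e = c e" if "e \<subseteq> B" "e \<noteq> {}" for e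
    using that xy AB unfolding c_def by auto
  have RA: "reach E c A u X Y v" if "reach E cA A u X Y v" for u X Y v
    using reach_cong[OF cA that] .
  have RB: "reach E c B u (\<pi> ` X) (\<pi> ` Y) v" if "reach E cB B u X Y v" for u X Y v
    using reach_cong[OF cB reach_comp_inj[OF inj that]] .
  have aA: "a \<mu> = aA \<mu>" if "fst \<mu> \<in> A" for \<mu> using that by (simp add: a_def)
  have aB: "a \<mu> = \<pi> (aB \<mu>)" if "fst \<mu> \<in> B" for \<mu> using that AB by (auto simp: a_def)
  have A0: "reach E c A u {} {s} x" if "u \<in> A" for u
    using RA[OF reach_sym[OF marked_colouringD(4)[OF A, of "(x, n)" u]]] that by (simp add: s_def)
  have AM: "reach E c A (fst \<mu>) {a \<mu>} {s} x" if "\<mu> \<in> M" "fst \<mu> \<in> A" for \<mu>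
  proof -
    \<comment> \<open>The label \<open>n\<close> is fresh, so the bridge mark differs from every
      mark in \<open>M\<close>, even one at \<open>x\<close>.\<close>
    have "\<mu> \<noteq> (x, n)" using that(1) n by force
    then have "reach E cA A (fst \<mu>) {aA \<mu>} {s} (fst (x, n))"
      using marked_colouringD(5)[OF A, of \<mu> "(x, n)"] that unfolding s_def by simp
    then show ?thesis using RA aA[OF that(2)] by auto
  qed
  have B0: "reach E c B y {s} {} v" if "v \<in> B" for v
  proof -
    have "reach E cB B (fst (y, n)) {t} {} v"
      using marked_colouringD(4)[OF B, of "(y, n)" v] that by (simp add: t_def)
    from RB[OF this] show ?thesis by (simp add: pt)
  qed
  have BM: "reach E c B y {s} {a \<mu>} (fst \<mu>)" if "\<mu> \<in> M" "fst \<mu> \<in> B" for \<mu>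
  proof -
    have "\<mu> \<noteq> (y, n)" using that(1) n by force
    then have "reach E cB B (fst (y, n)) {t} {aB \<mu>} (fst \<mu>)"
      using marked_colouringD(5)[OF B, of "(y, n)" \<mu>] that unfolding t_def by simp
    from RB[OF this] show ?thesis using aB[OF that(2)] by (simp add: pt)
  qed
  have glue: "reach E c (A \<union> B) u X Y v \<and> reach E c (A \<union> B) v Y X u"
    if "reach E c A u X {s} x" "reach E c B y {s} Y v" for u v X Y
    using reach_glue[of E c A u X x y B Y v] that AB xy(3) cxy reach_sym by metis
  have MAB: "fst \<mu> \<in> A \<or> fst \<mu> \<in> B" if "\<mu> \<in> M" for \<mu> using that M by auto
  have monoA: "reach E c (A \<union> B) u X Y v" if "reach E cA A u X Y v" for u v X Y
    using RA[OF that] reach_mono by (metis Un_upper1)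
  have monoB: "reach E c (A \<union> B) u (\<pi> ` X) (\<pi> ` Y) v" if "reach E cB B u X Y v" for u v X Y
    using RB[OF that] reach_mono by (metis Un_upper2)
  have "marked_colouring E k (A \<union> B) M c a"
    unfolding marked_colouring_def
  proof (intro conjI ballI allI impI)
    show "c e < k" for e using marked_colouringD(1)[OF A] marked_colouringD(1)[OF B] pk st by (simp add: c_def)
    show "a \<mu> < k" if "\<mu> \<in> M" for \<mu>
      using marked_colouringD(2)[OF A, of \<mu>] marked_colouringD(2)[OF B, of \<mu>] pk that MAB[OF that]
      by (auto simp: a_def)
  next
    fix u v assume "u \<in> A \<union> B" "v \<in> A \<union> B"
    then consider "u \<in> A" "v \<in> A" | "u \<in> B" "v \<in> B" | "u \<in> A" "v \<in> B" | "u \<in> B" "v \<in> A" by blast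
    then show "reach E c (A \<union> B) u {} {} v"
    proof cases
      case 1
      then show ?thesis using monoA marked_colouringD(3)[OF A] by blast
    next
      case 2
      then show ?thesis using monoB[OF marked_colouringD(3)[OF B], of u v] by simp
    qed (use glue A0 B0 in blast)+
  next
    fix \<mu> v assume m: "\<mu> \<in> M" "v \<in> A \<union> B"
    then consider "fst \<mu> \<in> A" "v \<in> A" | "fst \<mu> \<in> B" "v \<in> B" | "fst \<mu> \<in> A" "v \<in> B"
      | "fst \<mu> \<in> B" "v \<in> A" using MAB by blast
    then show "reach E c (A \<union> B) (fst \<mu>) {a \<mu>} {} v"
    proof cases
      case 1
      then have "reach E cA A (fst \<mu>) {aA \<mu>} {} v" using marked_colouringD(4)[OF A, of \<mu> v] m by simp
      then show ?thesis using monoA aA 1 by simp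
    next
      case 2
      then have "reach E cB B (fst \<mu>) {aB \<mu>} {} v" using marked_colouringD(4)[OF B, of \<mu> v] m by simp
      from monoB[OF this] show ?thesis using aB 2 by simp
    qed (use glue A0 B0 AM BM m in blast)+
  next
    fix \<mu> \<nu> assume m: "\<mu> \<in> M" "\<nu> \<in> M" "\<mu> \<noteq> \<nu>"
    then consider "fst \<mu> \<in> A" "fst \<nu> \<in> A" | "fst \<mu> \<in> B" "fst \<nu> \<in> B" | "fst \<mu> \<in> A" "fst \<nu> \<in> B"
      | "fst \<mu> \<in> B" "fst \<nu> \<in> A" using MAB by blast
    then show "reach E c (A \<union> B) (fst \<mu>) {a \<mu>} {a \<nu>} (fst \<nu>)"
    proof cases
      case 1
      then have "reach E cA A (fst \<mu>) {aA \<mu>} {aA \<nu>} (fst \<nu>)"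
        using marked_colouringD(5)[OF A, of \<mu> \<nu>] m by simp
      then show ?thesis using monoA aA 1 by simp
    next
      case 2
      then have "reach E cB B (fst \<mu>) {aB \<mu>} {aB \<nu>} (fst \<nu>)"
        using marked_colouringD(5)[OF B, of \<mu> \<nu>] m by simp
      from monoB[OF this] show ?thesis using aB 2 by simp
    qed (use glue AM BM m in blast)+
  qed
  then show ?thesis by blast
qed

text \<open>Removing the bridges in \<open>F\<close> leaves the parts in \<open>P\<close>, which may still contain bridges themselves.
  Edges are not restricted to \<open>V\<close>: all notions refer to the subgraph of \<open>E\<close> induced on \<open>V\<close>.\<close>

inductive bridge_dec :: "'a set set \<Rightarrow> 'a set \<Rightarrow> 'a set set \<Rightarrow> 'a set set \<Rightarrow> bool" for E where
  base: "cut_connected E V \<Longrightarrow> bridge_dec E V {V} {}"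
| step: "bridge_dec E A P F \<Longrightarrow> bridge_dec E B Q G \<Longrightarrow> A \<inter> B = {} \<Longrightarrow> x \<in> A \<Longrightarrow> y \<in> B \<Longrightarrow>
    {x, y} \<in> E \<Longrightarrow> (\<And>a b. a \<in> A \<Longrightarrow> b \<in> B \<Longrightarrow> {a, b} \<in> E \<Longrightarrow> {a, b} = {x, y}) \<Longrightarrow>
    bridge_dec E (A \<union> B) (P \<union> Q) (insert {x, y} (F \<union> G))"

section \<open>Parts and bridges of a decomposition\<close>

lemma bridge_dec_subset:
  "bridge_dec E V P F \<Longrightarrow> (\<forall>p\<in>P. p \<noteq> {} \<and> p \<subseteq> V) \<and> \<Union>P = V \<and> P \<noteq> {}"
  by (induction rule: bridge_dec.induct) (auto simp: cut_connected_def)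

lemma bridge_dec_disjoint:
  "bridge_dec E V P F \<Longrightarrow> pairwise disjnt P"
proof (induction rule: bridge_dec.induct)
  case (step A P F B Q G x y)
  have sub: "\<forall>p\<in>P. p \<subseteq> A" "\<forall>q\<in>Q. q \<subseteq> B"
    using bridge_dec_subset[OF step.hyps(1)] bridge_dec_subset[OF step.hyps(2)] by auto
  have cross: "disjnt p q" if "p \<in> P" "q \<in> Q" for p q
    using sub that step.hyps(3) unfolding disjnt_def by fast
  show ?case
    using step.IH cross unfolding pairwise_def by (meson UnE disjnt_sym)
qed auto

lemma bridge_dec_edges:
  "bridge_dec E V P F \<Longrightarrow> F \<subseteq> E \<and> (\<forall>e\<in>F. e \<noteq> {} \<and> e \<subseteq> V)"
proof (induction rule: bridge_dec.induct)
  case (step A P F B Q G x y)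
  show ?case using step.IH step.hyps(4-6) by auto
qed auto

lemma bridge_dec_edges_disjoint:
  assumes "bridge_dec E A P F" "bridge_dec E B Q G" "A \<inter> B = {}" "x \<in> A" "y \<in> B"
  shows "F \<inter> G = {}" "{x, y} \<notin> F \<union> G"
proof -
  have F: "e \<noteq> {}" "e \<subseteq> A" if "e \<in> F" for e using bridge_dec_edges[OF assms(1)] that by auto
  have G: "e \<subseteq> B" if "e \<in> G" for e using bridge_dec_edges[OF assms(2)] that by auto
  show "F \<inter> G = {}" using F G assms(3) by fast
  have "x \<notin> B" "y \<notin> A" using assms(3-5) by auto
  then show "{x, y} \<notin> F \<union> G" using F(2)[of "{x, y}"] G[of "{x, y}"] by auto
qed

text \<open>Contracting the parts turns the removed bridges into a tree, whence one more part than
  bridges.\<close>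

lemma bridge_dec_card:
  assumes "bridge_dec E V P F" "finite V"
  shows "finite P" "finite F" "card P = Suc (card F)"
proof -
  have "finite P \<and> finite F \<and> card P = Suc (card F)"
    using assms
  proof (induction rule: bridge_dec.induct)
    case (step A P F B Q G x y)
    have fin: "finite P" "finite Q" "finite F" "finite G"
      "card P = Suc (card F)" "card Q = Suc (card G)" using step.IH step.prems by auto
    have P: "p \<noteq> {}" "p \<subseteq> A" if "p \<in> P" for p using bridge_dec_subset[OF step.hyps(1)] that by auto
    have Q: "p \<subseteq> B" if "p \<in> Q" for p using bridge_dec_subset[OF step.hyps(2)] that by auto
    have PQ: "P \<inter> Q = {}" using P Q step.hyps(3) by fast
    show ?case
      using fin PQ bridge_dec_edges_disjoint[OF step.hyps(1-5)] by (simp add: card_Un_disjoint)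
  qed auto
  then show "finite P" "finite F" "card P = Suc (card F)" by auto
qed

lemma bridge_dec_card_step:
  assumes "bridge_dec E A P F" "bridge_dec E B Q G" "A \<inter> B = {}" "x \<in> A" "y \<in> B"
    "finite A" "finite B"
  shows "card (insert {x, y} (F \<union> G)) = card F + card G + 1"
  using bridge_dec_card[OF assms(1,6)] bridge_dec_card[OF assms(2,7)]
    bridge_dec_edges_disjoint[OF assms(1-5)] by (simp add: card_Un_disjoint)

text \<open>Passing to one side adds one mark but loses at least one bridge, so
  \<open>card M + card F\<close> stays at most \<open>k\<close>. A part without bridges thus has at
  most \<open>k\<close> marks, as \<open>strong_marked_colouring\<close> demands.\<close>

lemma bridge_dec_colouring:
  assumes "bridge_dec E V P F" "finite V" "\<forall>p\<in>P. bridgeless E p" "3 \<le> k"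
    "finite M" "fst ` M \<subseteq> V" "card M + card F \<le> k"
  shows "\<exists>c a. marked_colouring E k V M c a"
  using assms
proof (induction arbitrary: M rule: bridge_dec.induct)
  case (base V)
  then obtain c :: "'a set \<Rightarrow> nat" where c: "strong E c V" "\<forall>e. c e < 3"
    using bridgeless_strong[of V E] by auto
  have "\<forall>e. c e < k" using c(2) base.prems(3) by (meson less_le_trans)
  then show ?case using strong_marked_colouring[OF c(1), of k M] base.prems by auto
next
  case (step A P F B Q G x y)
  have fin: "finite A" "finite B" using step.prems(1) by auto
  obtain n where n: "n \<notin> snd ` M"
    using step.prems(4) by (meson ex_new_if_finite finite_imageI infinite_UNIV_nat)
  let ?MA = "{\<mu> \<in> M. fst \<mu> \<in> A}" and ?MB = "{\<mu> \<in> M. fst \<mu> \<in> B}"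
  have k: "card M + (card F + card G + 1) \<le> k"
    using step.prems(6) bridge_dec_card_step[OF step.hyps(1-5) fin] by simp
  have "card ?MA \<le> card M" "card ?MB \<le> card M" using step.prems(4) by (auto intro: card_mono)
  then have cards: "card (insert (x, n) ?MA) + card F \<le> k" "card (insert (y, n) ?MB) + card G \<le> k"
    using k step.prems(4) by (auto simp: card_insert_if)
  have img: "fst ` insert (x, n) ?MA \<subseteq> A" "fst ` insert (y, n) ?MB \<subseteq> B"
    using step.hyps(4,5) by auto
  obtain cA aA where A: "marked_colouring E k A (insert (x, n) ?MA) cA aA"
    using step.IH(1)[OF fin(1) _ step.prems(3) _ img(1) cards(1)] step.prems(2,4) by auto
  obtain cB aB where B: "marked_colouring E k B (insert (y, n) ?MB) cB aB"
    using step.IH(2)[OF fin(2) _ step.prems(3) _ img(2) cards(2)] step.prems(2,4) by auto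
  show ?case
    using marked_colouring_glue[OF A B n _ step.hyps(3-6)] step.prems(5) by blast
qed

section \<open>Refining a decomposition\<close>

lemma bridge_split:
  assumes c: "cut_connected E V" and b: "\<not> bridgeless E V"
  obtains A B x y where "A \<union> B = V" "A \<inter> B = {}" "x \<in> A" "y \<in> B" "{x, y} \<in> E"
    "\<And>a b. a \<in> A \<Longrightarrow> b \<in> B \<Longrightarrow> {a, b} \<in> E \<Longrightarrow> {a, b} = {x, y}"
    "cut_connected E A" "cut_connected E B"
proof -
  obtain e where "\<not> cut_connected (E - {e}) V" using b unfolding bridgeless_def by blast
  \<comment> \<open>No edge but \<open>e\<close> leaves \<open>A\<close>; as \<open>V\<close> is
    connected, \<open>e\<close> does leave it.\<close>
  then obtain A where A: "A \<subseteq> V" "A \<noteq> {}" "A \<noteq> V"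
    and "\<not> (\<exists>a\<in>A. \<exists>b\<in>V - A. {a, b} \<in> E - {e})"
    using c unfolding cut_connected_def by auto
  then have no: "\<And>a b. a \<in> A \<Longrightarrow> b \<in> V - A \<Longrightarrow> {a, b} \<notin> E - {e}" by blast
  obtain x y where xy: "x \<in> A" "y \<in> V" "y \<notin> A" "{x, y} \<in> E" by (rule cut_connectedD[OF c A])
  have e: "e = {x, y}" using no[of x y] xy by blast
  have cross: "{a, b} = {x, y}" if "a \<in> A" "b \<in> V - A" "{a, b} \<in> E" for a b
    using no[OF that(1,2)] that(3) e by blast
  \<comment> \<open>Edges leave \<open>A\<close> only at \<open>x\<close>. So an edge of
    \<open>V\<close> leaving a subset without \<open>x\<close> stays in \<open>A\<close>; a subset
    containing \<open>x\<close> is treated through its complement in \<open>A\<close>. The claim is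
    stated for arbitrary \<open>A\<close> and \<open>x\<close> to serve both sides.\<close>
  have side: "cut_connected E A"
    if cross: "\<And>a b. a \<in> A \<Longrightarrow> b \<in> V - A \<Longrightarrow> {a, b} \<in> E \<Longrightarrow> a = x" and A: "A \<subseteq> V" "x \<in> A" for A x
    unfolding cut_connected_def
  proof (intro conjI allI impI)
    fix S assume S: "S \<subseteq> A \<and> S \<noteq> {} \<and> S \<noteq> A"
    show "\<exists>a\<in>S. \<exists>b\<in>A - S. {a, b} \<in> E"
    proof (cases "x \<in> S")
      case False
      have "S \<subseteq> V" "S \<noteq> {}" "S \<noteq> V" using S A False by auto
      then obtain a b where "a \<in> S" "b \<in> V" "b \<notin> S" "{a, b} \<in> E" by (rule cut_connectedD[OF c])
      then show ?thesis using cross[of a b] S False by blast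
    next
      case True
      have "A - S \<subseteq> V" "A - S \<noteq> {}" "A - S \<noteq> V" using S A True by auto
      then obtain a b where ab: "a \<in> A - S" "b \<in> V" "b \<notin> A - S" "{a, b} \<in> E"
        by (rule cut_connectedD[OF c])
      then have "b \<in> S" using cross[of a b] True by blast
      moreover have "{b, a} \<in> E" using ab(4) by (simp add: insert_commute)
      ultimately show ?thesis using ab(1) by blast
    qed
  qed (use A in auto)
  have sideA: "cut_connected E A"
  proof (rule side[of A x])
    fix a b assume ab: "a \<in> A" "b \<in> V - A" "{a, b} \<in> E"
    then show "a = x" using cross[OF ab] xy by (auto simp: doubleton_eq_iff)
  qed (use A xy in auto)
  have sideB: "cut_connected E (V - A)"
  proof (rule side[of "V - A" y])
    fix a b assume ab: "a \<in> V - A" "b \<in> V - (V - A)" "{a, b} \<in> E"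
    then have "{b, a} = {x, y}" by (intro cross) (auto simp: insert_commute)
    then show "a = y" using ab xy by (auto simp: doubleton_eq_iff)
  qed (use xy in auto)
  show ?thesis
  proof (rule that[of A "V - A" x y])
    show "{a, b} = {x, y}" if "a \<in> A" "b \<in> V - A" "{a, b} \<in> E" for a b
      using cross[OF that] .
  qed (use A xy sideA sideB in auto)
qed

text \<open>A part with a bridge is split at the \<open>base\<close> step that introduced it. The
  later steps can be repeated, because their side conditions mention only the vertex sets and not
  the parts.\<close>

lemma bridge_dec_refine:
  assumes "bridge_dec E V P F" "finite V" "\<not> (\<forall>p\<in>P. bridgeless E p)"
  shows "\<exists>P' F'. bridge_dec E V P' F' \<and> card F' = Suc (card F)"
  using assms
proof (induction rule: bridge_dec.induct)
  case (base V)
  then obtain A B x y where AB: "A \<union> B = V" "A \<inter> B = {}" "x \<in> A" "y \<in> B" "{x, y} \<in> E"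
    "\<And>a b. a \<in> A \<Longrightarrow> b \<in> B \<Longrightarrow> {a, b} \<in> E \<Longrightarrow> {a, b} = {x, y}"
    "cut_connected E A" "cut_connected E B"
    using bridge_split[of E V] by (metis singletonD)
  have "bridge_dec E (A \<union> B) ({A} \<union> {B}) (insert {x, y} ({} \<union> {}))"
    using bridge_dec.step[OF bridge_dec.base[OF AB(7)] bridge_dec.base[OF AB(8)] AB(2-6)] .
  then show ?case using AB(1) by (intro exI conjI) (auto simp: card_insert_if)
next
  case (step A P F B Q G x y)
  have fin: "finite A" "finite B" using step.prems(1) by auto
  consider "\<not> (\<forall>p\<in>P. bridgeless E p)" | "\<not> (\<forall>p\<in>Q. bridgeless E p)" using step.prems by auto
  then show ?case
  proof cases
    case 1
    then obtain P' F' where P': "bridge_dec E A P' F'" "card F' = Suc (card F)"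
      using step fin by blast
    then show ?thesis
      using bridge_dec.step[OF P'(1) step.hyps(2-7)] bridge_dec_card_step[OF P'(1) step.hyps(2-5) fin]
        bridge_dec_card_step[OF step.hyps(1-5) fin] by (intro exI conjI) auto
  next
    case 2
    then obtain P' F' where P': "bridge_dec E B P' F'" "card F' = Suc (card G)"
      using step fin by blast
    then show ?thesis
      using bridge_dec.step[OF step.hyps(1) P'(1) step.hyps(3-7)]
        bridge_dec_card_step[OF step.hyps(1) P'(1) step.hyps(3-5) fin]
        bridge_dec_card_step[OF step.hyps(1-5) fin] by (intro exI conjI) auto
  qed
qed

text \<open>Bridges are removed one at a time, until all parts are bridgeless or exactly
  \<open>k + 1\<close> bridges are gone.\<close>

lemma bridge_dec_cases:
  assumes "cut_connected E V" "finite V"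
  shows "(\<exists>P F. bridge_dec E V P F \<and> card F \<le> k \<and> (\<forall>p\<in>P. bridgeless E p)) \<or>
    (\<exists>P F. bridge_dec E V P F \<and> card F = Suc k)"
proof -
  have "(\<exists>P F. bridge_dec E V P F \<and> card F < r \<and> (\<forall>p\<in>P. bridgeless E p)) \<or>
    (\<exists>P F. bridge_dec E V P F \<and> card F = r)" for r
  proof (induction r)
    case 0
    show ?case using bridge_dec.base[OF assms(1)] by (metis card.empty)
  next
    case (Suc r)
    then show ?case using bridge_dec_refine[OF _ assms(2)] by (metis less_Suc_eq)
  qed
  from this[of "Suc k"] show ?thesis by (simp add: less_Suc_eq_le)
qed

section \<open>Counting edges in graphs with many bridges\<close>

lemma bridge_dec_inner:
  assumes "bridge_dec E V P F" "{a, b} \<in> E" "a \<in> V" "b \<in> V"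
  shows "{a, b} \<in> F \<or> (\<exists>p\<in>P. {a, b} \<subseteq> p)"
  using assms
proof (induction rule: bridge_dec.induct)
  case (step A P F B Q G x y)
  consider "a \<in> A" "b \<in> A" | "a \<in> B" "b \<in> B" | "a \<in> A" "b \<in> B" | "b \<in> A" "a \<in> B"
    using step.prems by blast
  then show ?case
  proof cases
    case 3
    then show ?thesis using step.hyps(7)[OF 3] step.prems(1) by blast
  next
    case 4
    then show ?thesis using step.hyps(7)[OF 4] step.prems(1) by (simp add: insert_commute)
  qed (use step in blast)+
qed auto

lemma bridge_dec_no_bridges: "bridge_dec E V P {} \<Longrightarrow> P = {V}"
  by (cases rule: bridge_dec.cases) auto

text \<open>A part that met no earlier bridge is an entire side, and so contains an end of the
  bridge joining the sides.\<close>

lemma bridge_dec_meets: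
  "bridge_dec E V P F \<Longrightarrow> F \<noteq> {} \<Longrightarrow> p \<in> P \<Longrightarrow> \<exists>e\<in>F. e \<inter> p \<noteq> {}"
proof (induction arbitrary: p rule: bridge_dec.induct)
  case (step A P F B Q G x y)
  show ?case
  proof (cases "p \<in> P")
    case True
    show ?thesis
    proof (cases "F = {}")
      case True
      then have "x \<in> p" using \<open>p \<in> P\<close> bridge_dec_no_bridges[of E A P] step.hyps(1,4) by auto
      then show ?thesis by auto
    next
      case False
      then show ?thesis using step.IH(1)[OF _ \<open>p \<in> P\<close>] by auto
    qed
  next
    case False
    then have pQ: "p \<in> Q" using step.prems by blast
    show ?thesis
    proof (cases "G = {}")
      case True
      then have "y \<in> p" using pQ bridge_dec_no_bridges[of E B Q] step.hyps(2,5) by auto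
      then show ?thesis by auto
    next
      case False
      then show ?thesis using step.IH(2)[OF _ pQ] by auto
    qed
  qed
qed auto

section \<open>Convexity of the number of edges of a complete graph\<close>

lemma choose_two_add: "(x + y) choose 2 = (x choose 2) + (y choose 2) + x * y"
  by (induction y) (simp_all add: numeral_2_eq_2)

text \<open>Moving \<open>d = h - l\<close> vertices from one clique to the other loses
  \<open>l * d\<close> edges and gains \<open>a * d\<close>.\<close>

lemma choose_two_merge:
  assumes "l \<le> h" "l \<le> a"
  shows "(a choose 2) + (h choose 2) \<le> ((a + (h - l)) choose 2) + (l choose 2)"
proof -
  obtain d where h: "h = l + d" using assms(1) le_Suc_ex by blast
  have "l * d \<le> a * d" using assms(2) by simp
  then show ?thesis unfolding h by (simp add: choose_two_add)
qed

text \<open>The surplus of each part is moved to the clique of order \<open>a\<close>, which only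
  grows, so \<open>l p \<le> a\<close> persists.\<close>

lemma sum_choose_two_le:
  assumes "finite Q" "\<forall>p\<in>Q. l p \<le> h p \<and> l p \<le> a"
  shows "(a choose 2) + (\<Sum>p\<in>Q. h p choose 2) \<le>
    ((a + (\<Sum>p\<in>Q. h p - l p)) choose 2) + (\<Sum>p\<in>Q. l p choose 2)"
  using assms
proof (induction Q rule: finite_induct)
  case (insert q Q)
  have "l q \<le> a + (\<Sum>p\<in>Q. h p - l p)" using insert.prems by (simp add: trans_le_add1)
  then show ?case
    using insert.IH insert.prems insert.hyps
      choose_two_merge[of "l q" "h q" "a + (\<Sum>p\<in>Q. h p - l p)"]
    by (simp add: add.commute add.left_commute)
qed simp

text \<open>An edge at \<open>v\<close> is either a removed bridge or leads to one of the other
  \<open>card p - 1\<close> vertices of \<open>p\<close>.\<close>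

lemma degree_le_part:
  assumes E: "\<forall>e\<in>E. e \<subseteq> V \<and> card e = 2" and V: "finite V" and d: "bridge_dec E V P F"
    and p: "p \<in> P" "v \<in> p"
  shows "degree E v \<le> degree F v + (card p - 1)"
proof -
  have pV: "p \<subseteq> V" and finp: "finite p"
    using bridge_dec_subset[OF d] p(1) V finite_subset by auto
  have "{e \<in> E. v \<in> e} \<subseteq> {e \<in> F. v \<in> e} \<union> (\<lambda>w. {v, w}) ` (p - {v})"
  proof
    fix e assume e: "e \<in> {e \<in> E. v \<in> e}"
    then have "card e = 2" "v \<in> e" using E by auto
    then obtain w where w: "e = {v, w}" "v \<noteq> w" by (metis card_2_iff doubleton_eq_iff insertE singletonD)
    then have "w \<in> V" "v \<in> V" using e E by auto
    then consider "e \<in> F" | q where "q \<in> P" "e \<subseteq> q"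
      using bridge_dec_inner[OF d, of v w] e w by auto
    then show "e \<in> {e \<in> F. v \<in> e} \<union> (\<lambda>w. {v, w}) ` (p - {v})"
    proof cases
      case 1
      then show ?thesis using e by simp
    next
      case 2
      then have "q = p" using bridge_dec_disjoint[OF d] p w unfolding pairwise_def disjnt_def by blast
      then show ?thesis using 2 w by auto
    qed
  qed
  moreover have fin: "finite {e \<in> F. v \<in> e}" using bridge_dec_card(2)[OF d V] by simp
  ultimately have "degree E v \<le> card ({e \<in> F. v \<in> e} \<union> (\<lambda>w. {v, w}) ` (p - {v}))"
    unfolding degree_def using finp by (intro card_mono) auto
  also have "\<dots> \<le> degree F v + card ((\<lambda>w. {v, w}) ` (p - {v}))"
    unfolding degree_def by (rule card_Un_le)
  also have "card ((\<lambda>w. {v, w}) ` (p - {v})) \<le> card p - 1"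
    using card_image_le[of "p - {v}" "\<lambda>w. {v, w}"] finp p(2) by simp
  finally show ?thesis by simp
qed

text \<open>A part of order \<open>h \<le> \<delta>\<close> meets at least \<open>h (\<delta> - h + 1) \<ge> \<delta>\<close> bridge ends and every other part at
  least one, while there are only \<open>2 (k + 1)\<close> bridge ends in total.\<close>

lemma card_small_parts:
  assumes E: "\<forall>e\<in>E. e \<subseteq> V \<and> card e = 2" and V: "finite V" and d: "bridge_dec E V P F"
    and F: "card F = Suc k" and deg: "\<forall>v\<in>V. \<delta> \<le> degree E v" and \<delta>: "1 \<le> \<delta>"
  shows "card {p \<in> P. card p \<le> \<delta>} * (\<delta> - 1) \<le> k"
proof -
  let ?S = "{p \<in> P. card p \<le> \<delta>}"
  define inc where "inc p = (\<Sum>v\<in>p. degree F v)" for p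
  have finP: "finite P" and finF: "finite F" and cP: "card P = k + 2"
    using bridge_dec_card[OF d V] F by auto
  have sub: "p \<noteq> {}" "p \<subseteq> V" "finite p" if "p \<in> P" for p
    using bridge_dec_subset[OF d] that V finite_subset by auto
  have "(\<Sum>p\<in>P. inc p) = (\<Sum>v\<in>\<Union>P. degree F v)"
    unfolding inc_def using sub bridge_dec_disjoint[OF d]
    by (subst sum.Union_disjoint) (auto simp: pairwise_def disjnt_def)
  also have "\<Union>P = V" using bridge_dec_subset[OF d] by simp
  also have "(\<Sum>v\<in>V. degree F v) = 2 * card F"
    unfolding degree_def
  proof (rule sum_multicount[OF V finF], rule ballI)
    fix e assume "e \<in> F"
    then have "e \<subseteq> V" "card e = 2" using bridge_dec_edges[OF d] E by auto
    then have "{v \<in> V. v \<in> e} = e" by auto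
    then show "card {v \<in> V. v \<in> e} = 2" using \<open>card e = 2\<close> by simp
  qed
  finally have total: "(\<Sum>p\<in>P. inc p) = 2 * (k + 1)" using F by simp
  have one: "1 \<le> inc p" if p: "p \<in> P" for p
  proof -
    have "F \<noteq> {}" using F by auto
    then obtain e v where e: "e \<in> F" "v \<in> e" "v \<in> p" using bridge_dec_meets[OF d _ p] by blast
    then have "e \<in> {e \<in> F. v \<in> e}" by simp
    then have "degree F v \<noteq> 0" unfolding degree_def using finF by auto
    moreover have "degree F v \<le> inc p" unfolding inc_def
      using sub(3)[OF p] e(3) by (intro member_le_sum) auto
    ultimately show ?thesis by simp
  qed
  have small: "\<delta> \<le> inc p" if p: "p \<in> ?S" for p
  proof -
    have pP: "p \<in> P" and le: "card p \<le> \<delta>" using p by auto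
    have h1: "1 \<le> card p" using sub[OF pP] by (simp add: Suc_le_eq card_gt_0_iff)
    have "\<delta> - (card p - 1) \<le> degree F v" if "v \<in> p" for v
      using degree_le_part[OF E V d pP that] deg sub(2)[OF pP] that by fastforce
    then have "card p * (\<delta> - (card p - 1)) \<le> inc p"
      unfolding inc_def using sum_bounded_below[of p "\<delta> - (card p - 1)" "degree F"] by simp
    moreover obtain i j where "card p = i + 1" "\<delta> = i + 1 + j"
      using h1 le by (metis add.commute le_Suc_ex)
    \<comment> \<open>The right side is \<open>(i + 1) * (j + 1)\<close>, which is at least
      \<open>i + j + 1\<close>.\<close>
    then have "\<delta> \<le> card p * (\<delta> - (card p - 1))" by (simp add: algebra_simps)
    ultimately show ?thesis by linarith
  qed
  have "card ?S * \<delta> + (k + 2 - card ?S) \<le> (\<Sum>p\<in>?S. inc p) + (\<Sum>p\<in>P - ?S. inc p)"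
  proof (rule add_mono)
    show "card ?S * \<delta> \<le> (\<Sum>p\<in>?S. inc p)" using sum_bounded_below[of ?S \<delta> inc] small by simp
    have "card (P - ?S) = k + 2 - card ?S" using finP cP by (subst card_Diff_subset) auto
    then show "k + 2 - card ?S \<le> (\<Sum>p\<in>P - ?S. inc p)"
      using sum_bounded_below[of "P - ?S" 1 inc] one by simp
  qed
  also have "\<dots> = 2 * (k + 1)"
    using total sum.subset_diff[of ?S P inc] finP by auto
  finally have *: "card ?S * \<delta> + (k + 2 - card ?S) \<le> 2 * (k + 1)" .
  moreover have "card ?S \<le> k + 2" using card_mono[OF finP, of ?S] cP by auto
  moreover have "card ?S * \<delta> = card ?S * (\<delta> - 1) + card ?S"
    using \<delta> by (cases \<delta>) auto
  moreover have "b \<le> k" if "a + (k + 2 - c) \<le> 2 * (k + 1)" "c \<le> k + 2" "a = b + c" for a b c :: nat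
    using that by presburger
  ultimately show ?thesis by blast
qed

lemma bridge_dec_card_edges:
  assumes E: "\<forall>e\<in>E. e \<subseteq> V \<and> card e = 2" and V: "finite V" and d: "bridge_dec E V P F"
  shows "card E \<le> card F + (\<Sum>p\<in>P. card p choose 2)"
proof -
  have finP: "finite P" and finF: "finite F" using bridge_dec_card[OF d V] by auto
  have finp: "finite p" if "p \<in> P" for p using bridge_dec_subset[OF d] that V finite_subset by auto
  let ?I = "\<lambda>p. {e. e \<subseteq> p \<and> card e = 2}"
  have "E \<subseteq> F \<union> (\<Union>p\<in>P. ?I p)"
  proof
    fix e assume e: "e \<in> E"
    then obtain a b where "e = {a, b}" using E by (auto simp: card_2_iff)
    then show "e \<in> F \<union> (\<Union>p\<in>P. ?I p)" using bridge_dec_inner[OF d, of a b] e E by auto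
  qed
  moreover have "finite (F \<union> (\<Union>p\<in>P. ?I p))" using finP finF finp by auto
  ultimately have "card E \<le> card (F \<union> (\<Union>p\<in>P. ?I p))" by (rule card_mono[rotated])
  also have "\<dots> \<le> card F + card (\<Union>p\<in>P. ?I p)" by (rule card_Un_le)
  also have "card (\<Union>p\<in>P. ?I p) \<le> (\<Sum>p\<in>P. card (?I p))" by (rule card_UN_le[OF finP])
  also have "\<dots> = (\<Sum>p\<in>P. card p choose 2)" using finp by (simp add: n_subsets)
  finally show ?thesis by simp
qed

text \<open>One part \<open>j\<close> of order above \<open>\<delta>\<close> absorbs the surplus of
  the other \<open>k + 1\<close> parts: \<open>m\<close> of these, including all small ones, shrink
  to a single vertex and the rest to order \<open>\<delta> + 1\<close>.\<close>

lemma bridge_dec_edge_bound: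
  assumes E: "\<forall>e\<in>E. e \<subseteq> V \<and> card e = 2" and V: "finite V" and d: "bridge_dec E V P F"
    and F: "card F = Suc k" and deg: "\<forall>v\<in>V. \<delta> \<le> degree E v" and \<delta>: "1 \<le> \<delta>"
    and m: "\<delta> = 1 \<longrightarrow> m = k + 1" "2 \<le> \<delta> \<longrightarrow> m = k div (\<delta> - 1)" and large: "k + 2 \<le> card E"
  shows "card E \<le> ((card V - m - (k + 1 - m) * (\<delta> + 1)) choose 2)
           + (k + 1 - m) * ((\<delta> + 1) choose 2) + k + 1"
proof -
  let ?S = "{p \<in> P. card p \<le> \<delta>}"
  have finP: "finite P" and cP: "card P = k + 2" using bridge_dec_card[OF d V] F by auto
  have sub: "p \<noteq> {}" "p \<subseteq> V" "finite p" if "p \<in> P" for p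
    using bridge_dec_subset[OF d] that V finite_subset by auto
  have pos: "1 \<le> card p" if "p \<in> P" for p using sub[OF that] by (simp add: Suc_le_eq card_gt_0_iff)
  have edges: "card E \<le> k + 1 + (\<Sum>p\<in>P. card p choose 2)"
    using bridge_dec_card_edges[OF E V d] F by simp
  \<comment> \<open>For \<open>\<delta> \<ge> 2\<close> this follows from
    \<open>card_small_parts\<close>. For \<open>\<delta> = 1\<close> that bound is void; instead,
    the parts cannot all be single vertices.\<close>
  have mk: "m \<le> k + 1" and Sm: "card ?S \<le> m" and SP: "?S \<noteq> P"
  proof -
    have S2: "card ?S * (\<delta> - 1) \<le> k" by (rule card_small_parts[OF E V d F deg \<delta>])
    have "m \<le> k + 1 \<and> card ?S \<le> m \<and> ?S \<noteq> P"
    proof (cases "\<delta> = 1")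
      case True
      have "?S \<noteq> P"
      proof
        assume "?S = P"
        then have "\<forall>p\<in>P. card p = 1" using pos True by (metis (mono_tags, lifting) le_antisym mem_Collect_eq)
        \<comment> \<open>Only the \<open>k + 1\<close> removed bridges would remain as edges,
          against \<open>large\<close>.\<close>
        then have "(\<Sum>p\<in>P. card p choose 2) = 0" by (simp add: numeral_2_eq_2)
        then show False using edges large by simp
      qed
      then have "card ?S < card P" using finP by (intro psubset_card_mono) auto
      then show ?thesis using \<open>?S \<noteq> P\<close> m(1) True cP by simp
    next
      case False
      then have m': "m = k div (\<delta> - 1)" using m(2) \<delta> by simp
      then have "m \<le> k" by simp
      moreover have "card ?S \<le> m" using S2 False \<delta> m' by (simp add: less_eq_div_iff_mult_less_eq)
      ultimately show ?thesis using cP by auto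
    qed
    then show "m \<le> k + 1" "card ?S \<le> m" "?S \<noteq> P" by auto
  qed
  obtain j where "j \<in> P" "\<not> card j \<le> \<delta>" using SP by blast
  then have j: "j \<in> P" "\<delta> + 1 \<le> card j" by auto
  define Q where "Q = P - {j}"
  have Q: "finite Q" "card Q = k + 1" "?S \<subseteq> Q" "Q \<subseteq> P" unfolding Q_def using finP cP j by auto
  \<comment> \<open>The small parts are padded to exactly \<open>m\<close> parts.\<close>
  obtain T where T: "?S \<subseteq> T" "T \<subseteq> Q" "card T = m"
    using exists_subset_between[OF Sm _ Q(3,1)] mk Q(2) by auto
  define l where "l p = (if p \<in> T then 1 else \<delta> + 1)" for p
  have l: "\<forall>p\<in>Q. l p \<le> card p \<and> l p \<le> card j"
    using T Q(4) pos j(2) unfolding l_def by (auto simp: not_le Suc_le_eq)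
  have cQT: "card (Q - T) = k + 1 - m"
    using T Q by (metis card_Diff_subset finite_subset)
  have split: "(\<Sum>p\<in>Q. f (l p)) = m * f 1 + (k + 1 - m) * f (\<delta> + 1)" for f :: "nat \<Rightarrow> nat"
  proof -
    have "(\<Sum>p\<in>Q. f (l p)) = (\<Sum>p\<in>Q - T. f (l p)) + (\<Sum>p\<in>T. f (l p))"
      by (rule sum.subset_diff[OF T(2) Q(1)])
    also have "(\<Sum>p\<in>Q - T. f (l p)) = (k + 1 - m) * f (\<delta> + 1)" using cQT by (simp add: l_def)
    also have "(\<Sum>p\<in>T. f (l p)) = m * f 1" using T(3) by (simp add: l_def)
    finally show ?thesis by simp
  qed
  have "card V = (\<Sum>p\<in>P. card p)"
    using card_Union_disjoint[OF bridge_dec_disjoint[OF d]] sub(3) bridge_dec_subset[OF d] by simp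
  also have "\<dots> = card j + (\<Sum>p\<in>Q. card p)" unfolding Q_def by (rule sum.remove[OF finP j(1)])
  finally have cV: "card V = card j + (\<Sum>p\<in>Q. card p)" .
  have "(\<Sum>p\<in>Q. card p - l p) = (\<Sum>p\<in>Q. card p) - (m + (k + 1 - m) * (\<delta> + 1))"
    using l split[of "\<lambda>i. i"] by (simp add: sum_subtractf_nat)
  \<comment> \<open>This ensures that the subtractions from \<open>card V\<close> are not
    truncated.\<close>
  moreover have "m + (k + 1 - m) * (\<delta> + 1) \<le> (\<Sum>p\<in>Q. card p)"
    using sum_mono[of Q l card] l split[of "\<lambda>i. i"] by simp
  ultimately have eq: "card j + (\<Sum>p\<in>Q. card p - l p) = card V - m - (k + 1 - m) * (\<delta> + 1)"
    using cV by simp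
  have "(\<Sum>p\<in>P. card p choose 2) = (card j choose 2) + (\<Sum>p\<in>Q. card p choose 2)"
    unfolding Q_def by (rule sum.remove[OF finP j(1)])
  also have "\<dots> \<le> ((card j + (\<Sum>p\<in>Q. card p - l p)) choose 2) + (\<Sum>p\<in>Q. l p choose 2)"
    by (rule sum_choose_two_le[OF Q(1) l])
  also have "\<dots> = ((card V - m - (k + 1 - m) * (\<delta> + 1)) choose 2) + (k + 1 - m) * ((\<delta> + 1) choose 2)"
    unfolding eq using split[of "\<lambda>i. i choose 2"] by (simp add: numeral_2_eq_2)
  finally show ?thesis using edges by simp
qed

section \<open>The proper connection number\<close>

lemma alt_path_nth:
  assumes "alt_path E c p"
  shows "Suc i < length p \<Longrightarrow> {p ! i, p ! Suc i} \<in> E"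
    "Suc (Suc i) < length p \<Longrightarrow> c {p ! i, p ! Suc i} \<noteq> c {p ! Suc i, p ! Suc (Suc i)}"
proof -
  have "(Suc i < length p \<longrightarrow> {p ! i, p ! Suc i} \<in> E) \<and>
    (Suc (Suc i) < length p \<longrightarrow> c {p ! i, p ! Suc i} \<noteq> c {p ! Suc i, p ! Suc (Suc i)})"
    using assms
  proof (induction E c p arbitrary: i rule: alt_path.induct)
    case (1 E c x y p)
    then show ?case by (cases i; cases p) auto
  qed auto
  then show "Suc i < length p \<Longrightarrow> {p ! i, p ! Suc i} \<in> E"
    "Suc (Suc i) < length p \<Longrightarrow> c {p ! i, p ! Suc i} \<noteq> c {p ! Suc i, p ! Suc (Suc i)}" by auto
qed

text \<open>Since the vertices are distinct, two different edges of the path meet only if they are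
  consecutive.\<close>

lemma conn_path_proper_path:
  assumes "conn_path E c V u p v"
  shows "proper_path V E c u p v"
proof -
  have p: "alt_path E c p" "distinct p" "set p \<subseteq> V" "p \<noteq> []" "hd p = u" "last p = v"
    using assms unfolding conn_path_def by auto
  have "c e \<noteq> c f"
    if e: "e \<in> path_edges p" and f: "f \<in> path_edges p" and ef: "e \<noteq> f" "e \<inter> f \<noteq> {}" for e f
  proof -
    obtain i j where i: "e = {p ! i, p ! Suc i}" "Suc i < length p"
      and j: "f = {p ! j, p ! Suc j}" "Suc j < length p"
      using e f unfolding path_edges_def by blast
    have "i \<noteq> j" using ef(1) i j by auto
    then have "i = Suc j \<or> j = Suc i"
      using ef(2) i j p(2) by (auto simp: nth_eq_iff_index_eq)
    then show ?thesis using alt_path_nth(2)[OF p(1)] i j by metis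
  qed
  then show ?thesis
    unfolding proper_path_def is_path_def using p alt_path_nth(1)[OF p(1)] by auto
qed

text \<open>A path from \<open>S\<close> to a vertex outside enters its first outside vertex by the
  required edge.\<close>

lemma connected_graph_cut_connected:
  assumes "connected_graph V E"
  shows "cut_connected E V"
  unfolding cut_connected_def
proof (intro conjI allI impI)
  show "V \<noteq> {}" using assms unfolding connected_graph_def by blast
next
  fix S assume S: "S \<subseteq> V \<and> S \<noteq> {} \<and> S \<noteq> V"
  then obtain u v where uv: "u \<in> S" "v \<in> V" "v \<notin> S" by blast
  then obtain p where p: "is_path V E u p v" using assms S unfolding connected_graph_def by blast
  have "v \<in> set p" using p unfolding is_path_def by (metis last_in_set)
  then obtain p1 y p2 where sp: "p = p1 @ y # p2" "y \<notin> S" "\<forall>a\<in>set p1. a \<in> S"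
    using split_list_first_prop[of p "\<lambda>a. a \<notin> S"] uv(3) by blast
  have p1: "p1 \<noteq> []" using sp uv(1) p unfolding is_path_def by auto
  have "Suc (length p1 - 1) < length p" using sp(1) p1 by simp
  then have "{p ! (length p1 - 1), p ! Suc (length p1 - 1)} \<in> E"
    using p unfolding is_path_def by blast
  then have "{last p1, y} \<in> E" using sp(1) p1 by (simp add: nth_append last_conv_nth)
  moreover have "y \<in> V" using p sp(1) unfolding is_path_def by auto
  ultimately show "\<exists>x\<in>S. \<exists>y\<in>V - S. {x, y} \<in> E" using sp p1 by (metis DiffI last_in_set)
qed

text \<open>By connectedness an isolated vertex would be the whole graph.\<close>

lemma min_degree_pos:
  assumes "simple_graph V E" "cut_connected E V" "E \<noteq> {}"
  shows "1 \<le> min_degree V E"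
proof (rule ccontr)
  assume "\<not> 1 \<le> min_degree V E"
  then have 0: "min_degree V E = 0" by simp
  have V: "finite V" "V \<noteq> {}" using assms(1,2) unfolding simple_graph_def cut_connected_def by auto
  have "Min (degree E ` V) \<in> degree E ` V" using V by (intro Min_in) auto
  then obtain v where v: "v \<in> V" "degree E v = 0" using 0 unfolding min_degree_def by auto
  have "E \<subseteq> Pow V" using assms(1) unfolding simple_graph_def by blast
  then have "finite E" using V(1) by (meson finite_Pow_iff finite_subset)
  then have none: "e \<notin> E" if "v \<in> e" for e using v(2) that unfolding degree_def by auto
  have "V = {v}"
  proof (rule ccontr)
    assume "V \<noteq> {v}"
    then obtain a b where "a \<in> {v}" "{a, b} \<in> E" using cut_connectedD[OF assms(2), of "{v}"] v(1)
      by (metis empty_subsetI insert_not_empty insert_subset)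
    then show False using none by auto
  qed
  moreover obtain e where "e \<in> E" using assms(3) by blast
  ultimately have "e \<subseteq> {v}" "card e = 2" using assms(1) unfolding simple_graph_def by auto
  then show False using card_mono[of "{v}" e] by simp
qed

lemma min_degree_le: "finite V \<Longrightarrow> v \<in> V \<Longrightarrow> min_degree V E \<le> degree E v"
  unfolding min_degree_def by (simp add: Min_le)

theorem theorem3p1:
  fixes V :: "'a set" and E :: "'a set set" and k n m \<delta> :: nat
  assumes "k \<ge> 3"
    and "simple_graph V E"
    and "connected_graph V E"
    and "n = card V"
    and "\<delta> = min_degree V E"
    and "\<delta> = 1 \<longrightarrow> m = k + 1"
    and "\<delta> \<ge> 2 \<longrightarrow> m = k div (\<delta> - 1)"
    and "card E \<ge> ((n - m - (k + 1 - m) * (\<delta> + 1)) choose 2)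
           + (k + 1 - m) * ((\<delta> + 1) choose 2) + k + 2"
  shows "pc V E \<le> k"
proof -
  have V: "finite V" and E: "\<forall>e\<in>E. e \<subseteq> V \<and> card e = 2"
    using assms(2) unfolding simple_graph_def by auto
  have conn: "cut_connected E V" by (rule connected_graph_cut_connected[OF assms(3)])
  \<comment> \<open>The hypotheses determine \<open>m\<close> only for
    \<open>\<delta> \<ge> 1\<close>, so \<open>\<delta> = 0\<close> is excluded first.\<close>
  have "E \<noteq> {}" using assms(8) by auto
  then have \<delta>: "1 \<le> \<delta>" using min_degree_pos[OF assms(2) conn] assms(5) by simp
  have deg: "\<forall>v\<in>V. \<delta> \<le> degree E v" using min_degree_le[OF V] assms(5) by simp
  have large: "k + 2 \<le> card E" using assms(8) by simp
  \<comment> \<open>The bound of \<open>bridge_dec_edge_bound\<close> ends in \<open>k + 1\<close>,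
    the assumed one in \<open>k + 2\<close>.\<close>
  have "\<not> (\<exists>P F. bridge_dec E V P F \<and> card F = Suc k)"
    using bridge_dec_edge_bound[OF E V _ _ deg \<delta> assms(6,7) large] assms(4,8) by fastforce
  then obtain P F where "bridge_dec E V P F" "card F \<le> k" "\<forall>p\<in>P. bridgeless E p"
    using bridge_dec_cases[OF conn V, of k] by blast
  then obtain c a where c: "marked_colouring E k V {} c a"
    using bridge_dec_colouring[OF _ V _ assms(1), of E P F "{}"] by auto
  have "properly_connected V E c"
    unfolding properly_connected_def
    using marked_colouringD(3)[OF c] conn_path_proper_path unfolding reach_def by metis
  moreover have "c ` E \<subseteq> {..<k}" using marked_colouringD(1)[OF c] by auto
  ultimately show ?thesis unfolding pc_def by (intro Least_le) blast
qed

end
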